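(* Let $-1<\nu<0$. Then for every integer $n\ge1$, $$\sum_{k \ge 1} \frac{\big[(j_k^{\nu})'\big]^2}{ \Big[ \big[(j_k^{\nu})'\big]^2- \nu^2 \Big] \Big[ \big(j_n^{\nu}\big)^2 - \big[(j_k^{\nu})'\big]^2 \Big]^2} = \frac{1}{4\big(j_n^{\nu}\big)^2} - \frac{\big[(j_0^{\nu})'\big]^2}{\Big[ \big[(j_0^{\nu})'\big]^2+\nu^2 \Big] \Big[ \big(j_n^{\nu}\big)^2 + \big[(j_0^{\nu})'\big]^2\Big]^2}.$$
   Context: $\{j_n^{\nu}: n\ge1\}$ denotes the sequence of strictly positive zeros, in ascending order, of the Bessel function of the first kind $J_\nu$. $\{(j_n^{\nu})': n\ge1\}$ denotes the sequence of strictly positive zeros, in ascending order, of the derivative $J_\nu'$. For $-1<\nu<0$, $(j_0^{\nu})'$ denotes the unique strictly positive zero of $I_\nu'$, the derivative of the modified Bessel function of the first kind $I_\nu$. The prime in $(j_n^\nu)'$ is only notation. *)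

theory Defs
  imports "HOL-Analysis.Analysis"
begin

text \<open>
  Bessel functions of real order, intended for positive real argument only: on the
  remaining arguments \<^const>\<open>powr\<close> takes conventional values. The reciprocal Gamma
  function vanishes at the poles of Gamma, so the series are the usual ones for every order.
\<close>

definition bessel_J :: "real \<Rightarrow> real \<Rightarrow> real" where
  "bessel_J \<nu> x =
     (\<Sum>m. (- 1) ^ m / fact m * rGamma (\<nu> + real m + 1) * (x / 2) powr (2 * real m + \<nu>))"

definition bessel_I :: "real \<Rightarrow> real \<Rightarrow> real" where
  "bessel_I \<nu> x =
     (\<Sum>m. 1 / fact m * rGamma (\<nu> + real m + 1) * (x / 2) powr (2 * real m + \<nu>))"

text \<open>
  The \<open>n\<close>-th strictly positive zero in ascending order, for \<open>n \<ge> 1\<close>. Index \<open>0\<close> only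
  starts the recursion; its value \<open>0\<close> is not a zero. The recursion enumerates all positive
  zeros provided that these are infinite in number and do not accumulate at a finite point.
\<close>

primrec pos_zero :: "(real \<Rightarrow> real) \<Rightarrow> nat \<Rightarrow> real" where
  "pos_zero f 0 = 0"
| "pos_zero f (Suc n) = (LEAST x. pos_zero f n < x \<and> f x = 0)"

definition bessel_J_zero :: "real \<Rightarrow> nat \<Rightarrow> real" where
  "bessel_J_zero \<nu> = pos_zero (bessel_J \<nu>)"

definition bessel_J_deriv_zero :: "real \<Rightarrow> nat \<Rightarrow> real" where
  "bessel_J_deriv_zero \<nu> = pos_zero (deriv (bessel_J \<nu>))"

text \<open>For \<open>-1 < \<nu> < 0\<close> this is the quantity written \<open>(j\<^sub>0\<^sup>\<nu>)'\<close>; it is not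
  \<^term>\<open>bessel_J_deriv_zero \<nu> 0\<close>.\<close>

definition bessel_I_deriv_zero :: "real \<Rightarrow> real" where
  "bessel_I_deriv_zero \<nu> = (THE x. 0 < x \<and> deriv (bessel_I \<nu>) x = 0)"

end

theory Submission
  imports Defs "HOL-Complex_Analysis.Complex_Analysis"
begin

text \<open>
  Write \<open>J\<^sub>\<nu>(x) = (x/2)\<^sup>\<nu> phi(x\<^sup>2)\<close> and \<open>x J\<^sub>\<nu>'(x) = (x/2)\<^sup>\<nu> psi(x\<^sup>2)\<close> with entire functions \<open>phi\<close> and
  \<open>psi\<close>. The zeros \<open>e\<^sub>0 < 0 < e\<^sub>1 < e\<^sub>2 < \<dots>\<close> of \<open>psi\<close> are the number \<open>-[(j\<^sub>0)']\<^sup>2\<close> and the numbers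
  \<open>[(j\<^sub>k)']\<^sup>2\<close>, and moving the last term of the claim to the left makes it
  \<open>\<Sum>\<^sub>k e\<^sub>k / ((e\<^sub>k - \<nu>\<^sup>2) (a - e\<^sub>k)\<^sup>2) = 1/(4 a)\<close>, the sum running over all zeros of \<open>psi\<close>, at
  \<open>a = (j\<^sub>n)\<^sup>2\<close>. By Bessel's equation the residue of \<open>m = phi/psi\<close> at \<open>e\<^sub>k\<close> is \<open>- 2 e\<^sub>k / (e\<^sub>k - \<nu>\<^sup>2)\<close>,
  and \<open>phi(a) = 0\<close> gives \<open>m'(a) = 1/(2 a)\<close>. So the claim is half of the
  termwise derivative at \<open>a\<close> of the expansion of \<open>m\<close> into partial fractions.

  That this expansion has no entire part is shown without asymptotics of Bessel functions.
  Green's formula makes the functions \<open>s \<mapsto> phi(e\<^sub>k s)\<close> orthogonal on \<open>(0, 1]\<close> with weight \<open>s\<^sup>\<nu>\<close>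
  (\<open>overlap_integral\<close>), which also makes the zeros of \<open>psi\<close> real and simple. Bessel's
  inequality for \<open>phi(w s)\<close> then says that \<open>m\<close>, even with finitely many polar parts removed, has
  nonnegative imaginary part on the upper half plane (\<open>quotient_typically_real\<close>). A function with that property
  which is holomorphic in a large disc and real on the real line is nearly linear near the origin
  (\<open>typically_real_remainder\<close>, a consequence of Schwarz's lemma). Letting the number of removed
  poles grow, the remainder becomes linear, and its slope is \<open>0\<close> because \<open>m\<close> does not tend to
  \<open>- \<infinity>\<close> along the negative axis (\<open>mittag_leffler_derivative\<close>).

  It remains to see that the recursively chosen numbers enumerate all zeros. This needs
  infinitely many zeros of \<open>J\<^sub>\<nu>\<close>, hence by Rolle of \<open>J\<^sub>\<nu>'\<close>, and follows from a concavity
  argument (\<open>solution_oscillates\<close>).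
\<close>

section \<open>Everywhere convergent power series\<close>

definition everywhere_convergent :: "(nat \<Rightarrow> real) \<Rightarrow> bool" where
  "everywhere_convergent a \<longleftrightarrow> (\<forall>r. summable (\<lambda>m. a m * r ^ m))"

definition power_series :: "(nat \<Rightarrow> real) \<Rightarrow> 'a \<Rightarrow> 'a::{real_normed_field,banach}" where
  "power_series a z = (\<Sum>m. of_real (a m) * z ^ m)"

lemma summable_norm_power_series:
  fixes z :: "'a::{real_normed_field,banach}"
  assumes "everywhere_convergent a"
  shows "summable (\<lambda>m. norm (of_real (a m) * z ^ m))"
proof -
  have "summable (\<lambda>m. norm (a m * norm z ^ m))"
    using assms unfolding everywhere_convergent_def
    by (intro powser_insidea[where x = "norm z + 1"]) auto
  then show ?thesis by (simp add: norm_mult norm_power abs_mult)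
qed

lemma power_series_sums:
  fixes z :: "'a::{real_normed_field,banach}"
  assumes "everywhere_convergent a"
  shows "(\<lambda>m. of_real (a m) * z ^ m) sums power_series a z"
  unfolding power_series_def
  using summable_norm_cancel[OF summable_norm_power_series[OF assms]] by (rule summable_sums)

lemma power_series_of_real:
  assumes "everywhere_convergent a"
  shows "power_series a (of_real x :: 'a::{real_normed_field,banach}) = of_real (power_series a x)"
proof -
  have "(\<lambda>m. of_real (a m * x ^ m) :: 'a) sums of_real (power_series a x)"
    using power_series_sums[OF assms, of x] by (intro sums_of_real) simp
  then show ?thesis
    using power_series_sums[OF assms, of "of_real x :: 'a"] by (simp add: sums_unique2)
qed

lemma power_series_cnj:
  assumes "everywhere_convergent a"
  shows "power_series a (cnj z) = cnj (power_series a z)"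
proof -
  have "(\<lambda>m. cnj (of_real (a m) * z ^ m)) sums cnj (power_series a z)"
    using power_series_sums[OF assms, of z] by (simp only: sums_cnj)
  then show ?thesis
    using power_series_sums[OF assms, of "cnj z"] by (simp add: sums_unique2)
qed

lemma power_series_0 [simp]:
  "power_series a (0::'a::{real_normed_field,banach}) = of_real (a 0)"
  unfolding power_series_def using powser_zero[of "\<lambda>m. of_real (a m) :: 'a"] by simp

lemma everywhere_convergent_diffs:
  assumes "everywhere_convergent a"
  shows "everywhere_convergent (diffs a)"
  using assms termdiff_converges_all[of a] unfolding everywhere_convergent_def by blast

lemma power_series_deriv:
  fixes z :: "'a::{real_normed_field,banach}"
  assumes "everywhere_convergent a"
  shows "(power_series a has_field_derivative power_series (diffs a) z) (at z)"
proof -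
  have "((\<lambda>z. \<Sum>m. of_real (a m) * z ^ m) has_field_derivative
         (\<Sum>m. diffs (\<lambda>m. of_real (a m)) m * z ^ m)) (at z)"
    by (rule termdiffs_strong_converges_everywhere)
       (rule sums_summable[OF power_series_sums[OF assms]])
  then show ?thesis
    by (simp add: diffs_of_real power_series_def[abs_def])
qed

lemma power_series_euler:
  fixes z :: "'a::{real_normed_field,banach}"
  assumes "everywhere_convergent a"
  shows "(\<lambda>m. of_real (real m * a m) * z ^ m) sums (z * power_series (diffs a) z)"
proof -
  have "summable (\<lambda>m. diffs (\<lambda>m. of_real (a m)) m * z ^ m)"
    using sums_summable[OF power_series_sums[OF everywhere_convergent_diffs[OF assms], of z]]
    by (simp add: diffs_of_real)
  from sums_mult[OF diffs_equiv[OF this], of z]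
  have "(\<lambda>m. z * (of_nat m * of_real (a m) * z ^ (m - Suc 0))) sums (z * power_series (diffs a) z)"
    by (simp add: diffs_of_real power_series_def)
  moreover have "z * (of_nat m * of_real (a m) * z ^ (m - Suc 0)) = of_real (real m * a m) * z ^ m" for m
    by (cases m) (auto simp: algebra_simps)
  ultimately show ?thesis by simp
qed

lemma everywhere_convergent_mult_index:
  assumes "everywhere_convergent a"
  shows "everywhere_convergent (\<lambda>m. (c * real m + d) * a m)"
  unfolding everywhere_convergent_def
proof
  fix r :: real
  have "summable (\<lambda>m. c * (real m * a m * r ^ m) + d * (a m * r ^ m))"
    using sums_summable[OF power_series_euler[OF assms, of r]]
      sums_summable[OF power_series_sums[OF assms, of r]]
    by (intro summable_add summable_mult) auto
  then show "summable (\<lambda>m. (c * real m + d) * a m * r ^ m)"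
    by (simp add: algebra_simps)
qed

section \<open>The entire functions behind the Bessel functions\<close>

text \<open>
  Substituting \<open>w = x\<^sup>2\<close> strips the branch point from the Bessel functions: for \<open>x > 0\<close>,
  \<open>J\<^sub>\<nu>(x) = (x/2)\<^sup>\<nu> phi(x\<^sup>2)\<close>, \<open>x J\<^sub>\<nu>'(x) = (x/2)\<^sup>\<nu> psi(x\<^sup>2)\<close>, and replacing \<open>x\<^sup>2\<close> by \<open>- x\<^sup>2\<close> gives
  \<open>I\<^sub>\<nu>\<close> and \<open>x I\<^sub>\<nu>'\<close>. The positive zeros of \<open>J\<^sub>\<nu>'\<close> and those of \<open>I\<^sub>\<nu>'\<close> thus become the positive
  and the negative zeros of one entire function \<open>psi\<close>. Both functions are polymorphic
  because the argument needs them on the real line and in the complex plane.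
\<close>

locale bessel_order =
  fixes \<nu> :: real
  assumes order_gt: "-1 < \<nu>" and order_neg: "\<nu> < 0"
begin

definition coef :: "nat \<Rightarrow> real" where
  "coef m = (- 1 / 4) ^ m / fact m * rGamma (\<nu> + real m + 1)"

definition phi :: "'a \<Rightarrow> 'a::{real_normed_field,banach}" where
  "phi = power_series coef"

definition psi :: "'a \<Rightarrow> 'a::{real_normed_field,banach}" where
  "psi = power_series (\<lambda>m. (2 * real m + \<nu>) * coef m)"

lemma rGamma_shift_pos: "0 < rGamma (\<nu> + real m + 1)"
  using order_gt by (simp add: rGamma_inverse_Gamma)

lemma coef_Suc: "4 * (real m + 1) * (real m + 1 + \<nu>) * coef (Suc m) = - coef m"
proof -
  have "rGamma (\<nu> + real m + 1) = (\<nu> + real m + 1) * rGamma (\<nu> + real (Suc m) + 1)"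
    using rGamma_plus1[of "\<nu> + real m + 1"] by (simp add: add_ac)
  then show ?thesis
    by (simp add: coef_def divide_simps) (simp add: algebra_simps)
qed

lemma coef_0: "coef 0 > 0"
  using rGamma_shift_pos[of 0] by (simp add: coef_def)

lemma everywhere_convergent_coef: "everywhere_convergent coef"
  unfolding everywhere_convergent_def
proof
  fix r :: real
  have "(\<lambda>m. norm r / (4 * (real m + 1) * (real m + 1 + \<nu>))) \<longlonglongrightarrow> 0"
    by real_asymp
  then have "\<forall>\<^sub>F m in sequentially. norm r / (4 * (real m + 1) * (real m + 1 + \<nu>)) < 1/2"
    by (rule order_tendstoD) simp
  then obtain N where N: "\<And>m. m \<ge> N \<Longrightarrow> norm r / (4 * (real m + 1) * (real m + 1 + \<nu>)) < 1/2"
    by (auto simp: eventually_sequentially)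
  show "summable (\<lambda>m. coef m * r ^ m)"
  proof (rule summable_ratio_test[of "1/2" N])
    fix m assume "m \<ge> N"
    have pos: "4 * (real m + 1) * (real m + 1 + \<nu>) > 0"
      using order_gt by simp
    have "coef (Suc m) = - coef m / (4 * (real m + 1) * (real m + 1 + \<nu>))"
      using coef_Suc[of m] pos by (metis less_irrefl nonzero_mult_div_cancel_left)
    then have "coef (Suc m) * r ^ Suc m
        = - (r / (4 * (real m + 1) * (real m + 1 + \<nu>)) * (coef m * r ^ m))"
      by simp
    then have "norm (coef (Suc m) * r ^ Suc m)
        = norm r / \<bar>4 * (real m + 1) * (real m + 1 + \<nu>)\<bar> * norm (coef m * r ^ m)"
      by (simp only: real_norm_def abs_minus_cancel abs_mult abs_divide)
    also have "\<dots> = norm r / (4 * (real m + 1) * (real m + 1 + \<nu>)) * norm (coef m * r ^ m)"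
      using pos by (simp only: abs_of_pos)
    also have "\<dots> \<le> 1/2 * norm (coef m * r ^ m)"
      using N[OF \<open>m \<ge> N\<close>] by (intro mult_right_mono) auto
    finally show "norm (coef (Suc m) * r ^ Suc m) \<le> 1/2 * norm (coef m * r ^ m)" .
  qed simp
qed

lemma everywhere_convergent_coef2: "everywhere_convergent (\<lambda>m. (2 * real m + \<nu>) * coef m)"
  by (rule everywhere_convergent_mult_index[OF everywhere_convergent_coef])

definition phi' :: "'a \<Rightarrow> 'a::{real_normed_field,banach}" where
  "phi' = power_series (diffs coef)"

definition psi' :: "'a \<Rightarrow> 'a::{real_normed_field,banach}" where
  "psi' = power_series (diffs (\<lambda>m. (2 * real m + \<nu>) * coef m))"

lemma phi_deriv: "(phi has_field_derivative phi' z) (at z)"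
  unfolding phi_def phi'_def by (rule power_series_deriv[OF everywhere_convergent_coef])

lemma psi_deriv: "(psi has_field_derivative psi' z) (at z)"
  unfolding psi_def psi'_def by (rule power_series_deriv[OF everywhere_convergent_coef2])

text \<open>
  With \<open>\<theta> = x d/dx = 2 w d/dw\<close>, the two systems \<open>phi_system\<close> and \<open>psi_system\<close> are
  \<open>\<theta> J = x J'\<close> and Bessel's equation \<open>\<theta>\<^sup>2 J = (\<nu>\<^sup>2 - x\<^sup>2) J\<close>.
\<close>

lemma phi_system:
  "2 * z * phi' z = psi z - of_real \<nu> * phi (z::'a::{real_normed_field,banach})"
proof -
  have "(\<lambda>m. 2 * (of_real (real m * coef m) * z ^ m) + of_real \<nu> * (of_real (coef m) * z ^ m))
        sums (2 * (z * phi' z) + of_real \<nu> * phi z)"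
    unfolding phi_def phi'_def
    by (intro sums_add sums_mult power_series_euler power_series_sums everywhere_convergent_coef)
  moreover have "(\<lambda>m. 2 * (of_real (real m * coef m) * z ^ m) + of_real \<nu> * (of_real (coef m) * z ^ m))
     = (\<lambda>m. of_real ((2 * real m + \<nu>) * coef m) * z ^ m)"
    by (rule ext) (simp add: algebra_simps)
  ultimately show ?thesis
    using power_series_sums[OF everywhere_convergent_coef2, of z]
    by (simp add: psi_def sums_unique2 algebra_simps)
qed

lemma psi_system:
  "2 * z * psi' z = ((of_real \<nu>)\<^sup>2 - z) * phi z - of_real \<nu> * psi (z::'a::{real_normed_field,banach})"
proof -
  let ?b = "\<lambda>m. (2 * real m + \<nu>) * coef m"
  have A: "(\<lambda>m. 2 * (of_real (real m * ?b m) * z ^ m) + of_real \<nu> * (of_real (?b m) * z ^ m)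
          - (of_real \<nu>)\<^sup>2 * (of_real (coef m) * z ^ m))
        sums (2 * (z * psi' z) + of_real \<nu> * psi z - (of_real \<nu>)\<^sup>2 * phi z)"
    unfolding phi_def psi_def psi'_def
    by (intro sums_add sums_diff sums_mult power_series_euler power_series_sums
         everywhere_convergent_coef everywhere_convergent_coef2)
  let ?t = "\<lambda>m. of_real (4 * real m * (real m + \<nu>) * coef m) * z ^ m"
  have "(\<lambda>m. - (z * (of_real (coef m) * z ^ m))) sums (- (z * phi z))"
    unfolding phi_def
    by (intro sums_minus sums_mult power_series_sums everywhere_convergent_coef)
  moreover have "- (z * (of_real (coef m) * z ^ m)) = ?t (Suc m)" for m
  proof -
    have "4 * real (Suc m) * (real (Suc m) + \<nu>) * coef (Suc m) = - coef m"
      using coef_Suc[of m] by (simp add: algebra_simps)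
    then show ?thesis by (simp only:) simp
  qed
  ultimately have "(\<lambda>m. ?t (Suc m)) sums (- (z * phi z))" by simp
  then have "?t sums (- (z * phi z))"
    using sums_Suc_iff[of ?t "- (z * phi z)"] by simp
  moreover have "(\<lambda>m. 2 * (of_real (real m * ?b m) * z ^ m) + of_real \<nu> * (of_real (?b m) * z ^ m)
          - (of_real \<nu>)\<^sup>2 * (of_real (coef m) * z ^ m)) = ?t"
    by (rule ext) (simp add: algebra_simps power2_eq_square)
  ultimately have "2 * (z * psi' z) + of_real \<nu> * psi z - (of_real \<nu>)\<^sup>2 * phi z = - (z * phi z)"
    using A by (simp add: sums_unique2)
  then show ?thesis by (simp add: algebra_simps)
qed

lemma phi_of_real: "phi (of_real x) = of_real (phi x)"
  unfolding phi_def by (rule power_series_of_real[OF everywhere_convergent_coef])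
lemma psi_of_real: "psi (of_real x) = of_real (psi x)"
  unfolding psi_def by (rule power_series_of_real[OF everywhere_convergent_coef2])
lemma phi_cnj: "phi (cnj z) = cnj (phi z)"
  unfolding phi_def by (rule power_series_cnj[OF everywhere_convergent_coef])
lemma psi_cnj: "psi (cnj z) = cnj (psi z)"
  unfolding psi_def by (rule power_series_cnj[OF everywhere_convergent_coef2])
lemma phi_0: "phi 0 = of_real (coef 0)"
  by (simp add: phi_def)
lemma psi_0: "psi 0 = of_real (\<nu> * coef 0)"
  by (simp add: psi_def)

end

section \<open>Orthogonality relations on the unit interval\<close>

context bessel_order begin

text \<open>
  The fundamental theorem of calculus for \<open>s\<^sup>\<nu> E(s)\<close>. Since \<open>E\<close> vanishes at \<open>0\<close>, this
  antiderivative is of size \<open>s\<^bsup>\<nu>+1\<^esup>\<close> there and so, because \<open>\<nu> > -1\<close>, continuous at \<open>0\<close>, even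
  though the weight \<open>s\<^sup>\<nu>\<close> is unbounded.
\<close>

lemma weighted_integral:
  fixes E E' g :: "complex \<Rightarrow> complex"
  assumes E0: "E 0 = 0"
    and der: "\<And>S. (E has_field_derivative E' S) (at S)"
    and eq: "\<And>S. of_real \<nu> * E S + S * E' S = S * g S"
  shows "((\<lambda>s. (s powr \<nu>) *\<^sub>R g (of_real s)) has_integral E 1) {0..1}"
proof -
  define F where "F = (\<lambda>s::real. (s powr \<nu>) *\<^sub>R E (of_real s))"
  have derF: "(F has_vector_derivative (s powr \<nu>) *\<^sub>R g (of_real s)) (at s)" if "s > 0" for s
  proof -
    have "(F has_vector_derivative
        ((s powr \<nu>) *\<^sub>R E' (of_real s) + (\<nu> * s powr (\<nu> - 1)) *\<^sub>R E (of_real s))) (at s)"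
      unfolding F_def using that
      by (intro has_vector_derivative_scaleR has_vector_derivative_real_field der
           has_real_derivative_powr)
    moreover have "of_real s * ((s powr \<nu>) *\<^sub>R E' (of_real s) + (\<nu> * s powr (\<nu> - 1)) *\<^sub>R E (of_real s))
        = of_real s * ((s powr \<nu>) *\<^sub>R g (of_real s))"
    proof -
      have "s powr \<nu> = s * s powr (\<nu> - 1)"
        using that by (simp add: powr_diff)
      then have "of_real s * ((s powr \<nu>) *\<^sub>R E' (of_real s) + (\<nu> * s powr (\<nu> - 1)) *\<^sub>R E (of_real s))
        = (s powr \<nu>) *\<^sub>R (of_real \<nu> * E (of_real s) + of_real s * E' (of_real s))"
        by (simp add: scaleR_conv_of_real algebra_simps)
      also have "\<dots> = (s powr \<nu>) *\<^sub>R (of_real s * g (of_real s))"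
        by (simp only: eq)
      finally show ?thesis by simp
    qed
    then have "(s powr \<nu>) *\<^sub>R E' (of_real s) + (\<nu> * s powr (\<nu> - 1)) *\<^sub>R E (of_real s)
        = (s powr \<nu>) *\<^sub>R g (of_real s)"
      using that mult_left_cancel[of "complex_of_real s"] by (metis of_real_eq_0_iff less_irrefl)
    ultimately show ?thesis by simp
  qed
  obtain Q where Q: "\<And>z. E z - E 0 = Q z * (z - 0)" "isCont Q 0"
    using der[of 0] unfolding CARAT_DERIV by auto
  have F_eq: "F s = (s powr (\<nu> + 1)) *\<^sub>R Q (of_real s)" if "s \<ge> 0" for s
  proof (cases "s = 0")
    case False
    have "E (of_real s) = Q (of_real s) * of_real s"
      using Q(1)[of "of_real s"] by (simp only: E0 diff_zero)
    then show ?thesis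
      using that False by (simp only: F_def powr_add) (simp add: scaleR_conv_of_real)
  qed (simp add: F_def)
  have "continuous_on {0..1} F"
    unfolding continuous_on_eq_continuous_within
  proof
    fix s :: real assume s: "s \<in> {0..1}"
    show "continuous (at s within {0..1}) F"
    proof (cases "s = 0")
      case False
      with s have "s > 0" by simp
      then show ?thesis
        by (rule continuous_at_imp_continuous_at_within[OF has_vector_derivative_continuous[OF derF]])
    next
      case True
      have "continuous_on {0..1} (\<lambda>s::real. s powr (\<nu> + 1))"
        using order_gt by (intro continuous_on_powr') (auto intro: continuous_intros)
      then have p: "((\<lambda>s::real. s powr (\<nu> + 1)) \<longlongrightarrow> 0) (at 0 within {0..1})"
        unfolding continuous_on_def by force
      have "((\<lambda>s. complex_of_real s) \<longlongrightarrow> of_real 0) (at 0 within {0..1})"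
        by (intro tendsto_of_real tendsto_ident_at)
      then have q: "((\<lambda>s. Q (of_real s)) \<longlongrightarrow> Q 0) (at (0::real) within {0..1})"
        by (intro isCont_tendsto_compose[OF Q(2)]) simp
      have "((\<lambda>s. (s powr (\<nu> + 1)) *\<^sub>R Q (of_real s)) \<longlongrightarrow> 0) (at 0 within {0..1})"
        using tendsto_scaleR[OF p q] by simp
      then have "(F \<longlongrightarrow> 0) (at 0 within {0..1})"
        by (rule Lim_transform_eventually) (auto simp: eventually_at_filter F_eq)
      then show ?thesis
        using True by (simp add: continuous_within F_def)
    qed
  qed
  then have "((\<lambda>s. (s powr \<nu>) *\<^sub>R g (of_real s)) has_integral (F 1 - F 0)) {0..1}"
    by (intro fundamental_theorem_of_calculus_interior derF) auto
  then show ?thesis by (simp add: F_def)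
qed

text \<open>
  The value of \<open>\<integral> s\<^sup>\<nu> phi(w s) phi(z s) ds\<close> over the unit interval, in the closed form that Green's
  formula gives. The second case is \<open>0/0\<close> on the diagonal, where its limit takes over.
\<close>

definition overlap :: "complex \<Rightarrow> complex \<Rightarrow> complex" where
  "overlap w z = (if w = z then ((psi w)\<^sup>2 - ((of_real \<nu>)\<^sup>2 - w) * (phi w)\<^sup>2) / w
                  else 2 * (phi w * psi z - psi w * phi z) / (w - z))"

text \<open>
  In both cases the antiderivative, without its factor \<open>s\<^sup>\<nu>\<close>, is the formula for \<open>overlap\<close> with
  \<open>w s\<close> and \<open>z s\<close> in place of \<open>w\<close> and \<open>z\<close>. For \<open>w \<noteq> z\<close> it is the Wronskian of two solutions of
  Bessel's equation; on the diagonal it is the energy \<open>(\<theta> J)\<^sup>2 - (\<nu>\<^sup>2 - x\<^sup>2) J\<^sup>2\<close>.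
\<close>

lemma overlap_integral:
  assumes "w \<noteq> 0"
  shows "((\<lambda>s. (s powr \<nu>) *\<^sub>R (phi (w * of_real s) * phi (z * of_real s)))
            has_integral overlap w z) {0..1}"
proof -
  have p: "((\<lambda>S. phi (u * S)) has_field_derivative u * phi' (u * S)) (at S)" for u S :: complex
    by (rule DERIV_chain2[OF phi_deriv, THEN DERIV_cong]) (auto intro!: derivative_eq_intros)
  have q: "((\<lambda>S. psi (u * S)) has_field_derivative u * psi' (u * S)) (at S)" for u S :: complex
    by (rule DERIV_chain2[OF psi_deriv, THEN DERIV_cong]) (auto intro!: derivative_eq_intros)
  have ps: "S * (u * phi' (u * S)) = (psi (u * S) - of_real \<nu> * phi (u * S)) / 2" for u S :: complex
    using phi_system[of "u * S"] by (simp add: algebra_simps)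
  have qs: "S * (u * psi' (u * S)) = (((of_real \<nu>)\<^sup>2 - u * S) * phi (u * S) - of_real \<nu> * psi (u * S)) / 2"
    for u S :: complex
    using psi_system[of "u * S"] by (simp add: algebra_simps)
  show ?thesis
  proof (cases "w = z")
    case False
    define c where "c = 2 / (w - z)"
    have "w - z \<noteq> 0" using False by simp
    then have c: "c * (w - z) = 2"
      using c_def nonzero_eq_divide_eq by metis
    define E where "E = (\<lambda>S. c * (phi (w * S) * psi (z * S) - psi (w * S) * phi (z * S)))"
    define E' where "E' = (\<lambda>S. c *
       ((w * phi' (w * S)) * psi (z * S) + phi (w * S) * (z * psi' (z * S))
        - ((w * psi' (w * S)) * phi (z * S) + psi (w * S) * (z * phi' (z * S)))))"
    have "((\<lambda>s. (s powr \<nu>) *\<^sub>R (phi (w * of_real s) * phi (z * of_real s))) has_integral E 1) {0..1}"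
    proof (rule weighted_integral)
      show "E 0 = 0" by (simp add: E_def phi_0 psi_0)
      show "(E has_field_derivative E' S) (at S)" for S
        unfolding E_def E'_def
        by (rule derivative_eq_intros p q refl)+ (simp add: algebra_simps)
      show "of_real \<nu> * E S + S * E' S = S * (phi (w * S) * phi (z * S))" for S
      proof -
        have "S * E' S = c *
          ((S * (w * phi' (w * S))) * psi (z * S) + phi (w * S) * (S * (z * psi' (z * S)))
          - ((S * (w * psi' (w * S))) * phi (z * S) + psi (w * S) * (S * (z * phi' (z * S)))))"
          by (simp add: E'_def algebra_simps)
        also have "\<dots> = c * (w - z) / 2 * (S * (phi (w * S) * phi (z * S))) - of_real \<nu> * E S"
          unfolding ps qs E_def by (simp add: field_simps)
        finally show ?thesis by (simp add: c)
      qed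
    qed
    then show ?thesis using False by (simp add: E_def overlap_def c_def)
  next
    case True
    define c where "c = 1 / w"
    have c: "c * w = 1" using assms by (simp add: c_def)
    define E where "E = (\<lambda>S. c * ((psi (w * S))\<^sup>2 - ((of_real \<nu>)\<^sup>2 - w * S) * (phi (w * S))\<^sup>2))"
    define E' where "E' = (\<lambda>S. c * (2 * psi (w * S) * (w * psi' (w * S))
       - ((of_real \<nu>)\<^sup>2 - w * S) * (2 * phi (w * S) * (w * phi' (w * S))) + w * (phi (w * S))\<^sup>2))"
    have "((\<lambda>s. (s powr \<nu>) *\<^sub>R (phi (w * of_real s) * phi (w * of_real s))) has_integral E 1) {0..1}"
    proof (rule weighted_integral)
      show "E 0 = 0" by (simp add: E_def phi_0 psi_0 power2_eq_square)
      show "(E has_field_derivative E' S) (at S)" for S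
        unfolding E_def E'_def
        by (rule derivative_eq_intros p q refl)+ (simp add: algebra_simps)
      show "of_real \<nu> * E S + S * E' S = S * (phi (w * S) * phi (w * S))" for S
      proof -
        have "S * E' S = c * (2 * psi (w * S) * (S * (w * psi' (w * S)))
         - ((of_real \<nu>)\<^sup>2 - w * S) * (2 * phi (w * S) * (S * (w * phi' (w * S)))) + S * w * (phi (w * S))\<^sup>2)"
          by (simp add: E'_def algebra_simps)
        also have "\<dots> = c * w * (S * (phi (w * S) * phi (w * S))) - of_real \<nu> * E S"
          unfolding ps qs E_def by (simp add: field_simps power2_eq_square)
        finally show ?thesis by (simp add: c)
      qed
    qed
    then show ?thesis using True assms by (simp add: E_def c_def overlap_def)
  qed
qed

lemma overlap_sym: "overlap w z = overlap z w"
proof (cases "w = z")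
  case False
  have "2 * (phi w * psi z - psi w * phi z) / (w - z) = - (2 * (phi w * psi z - psi w * phi z)) / - (w - z)"
    by (rule minus_divide_divide[symmetric])
  also have "\<dots> = 2 * (phi z * psi w - psi z * phi w) / (z - w)"
    by (simp add: algebra_simps)
  finally show ?thesis using False by (simp add: overlap_def)
qed simp

lemma cnj_overlap: "cnj (overlap w z) = overlap (cnj w) (cnj z)"
  by (auto simp: overlap_def phi_cnj psi_cnj complex_cnj_cancel_iff)

lemma continuous_on_phi: "continuous_on A (phi :: 'a \<Rightarrow> 'a::{real_normed_field,banach})"
  using phi_deriv DERIV_isCont continuous_at_imp_continuous_on by blast

text \<open>
  As \<open>\<nu> < 0\<close>, the weight \<open>s\<^sup>\<nu>\<close> is at least \<open>1\<close>, so that the integral dominates that of the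
  continuous function \<open>\<bar>phi(w s)\<bar>\<^sup>2\<close>, which is positive at \<open>s = 0\<close>.
\<close>

lemma overlap_cnj_pos:
  assumes "w \<noteq> 0"
  shows "Re (overlap w (cnj w)) > 0"
proof -
  define f where "f = (\<lambda>s. s powr \<nu> * (cmod (phi (w * of_real s)))\<^sup>2)"
  define g where "g = (\<lambda>s. (cmod (phi (w * of_real s)))\<^sup>2)"
  have fI: "(f has_integral Re (overlap w (cnj w))) {0..1}"
  proof -
    have "(Re \<circ> (\<lambda>s. (s powr \<nu>) *\<^sub>R (phi (w * of_real s) * phi (cnj w * of_real s)))
            has_integral Re (overlap w (cnj w))) {0..1}"
      by (rule has_integral_linear[OF overlap_integral[OF assms] bounded_linear_Re])
    moreover have "Re \<circ> (\<lambda>s. (s powr \<nu>) *\<^sub>R (phi (w * of_real s) * phi (cnj w * of_real s))) = f"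
    proof
      fix s
      have "phi (cnj w * of_real s) = cnj (phi (w * of_real s))"
        using phi_cnj[of "w * of_real s"] by simp
      then show "(Re \<circ> (\<lambda>s. (s powr \<nu>) *\<^sub>R (phi (w * of_real s) * phi (cnj w * of_real s)))) s = f s"
        by (simp only: f_def o_def) (simp add: complex_mult_cnj cmod_power2)
    qed
    ultimately show ?thesis by simp
  qed
  have contg: "continuous_on {0..1} g"
    unfolding g_def
    by (intro continuous_intros continuous_on_compose2[OF continuous_on_phi[of UNIV]]) auto
  then have gI: "(g has_integral integral {0..1} g) {0..1}"
    by (intro integrable_integral integrable_continuous_real)
  \<comment> \<open>The convention \<open>0 powr \<nu> = 0\<close> breaks \<open>g \<le> f\<close> at the single point \<open>0\<close>.\<close>
  define f1 where "f1 = (\<lambda>s. if s = 0 then g 0 else f s)"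
  have "(f1 has_integral Re (overlap w (cnj w))) {0..1}"
    by (rule has_integral_spike_finite[OF _ _ fI, of "{0}"]) (auto simp: f1_def)
  then have le: "integral {0..1} g \<le> Re (overlap w (cnj w))"
  proof (rule has_integral_le[OF gI])
    fix s :: real assume s: "s \<in> {0..1}"
    show "g s \<le> f1 s"
    proof (cases "s = 0")
      case False
      then have "s powr \<nu> \<ge> 1"
        using s order_neg powr_mono'[of \<nu> 0 s] by simp
      then show ?thesis
        using False mult_right_mono[of 1 "s powr \<nu>" "(cmod (phi (w * of_real s)))\<^sup>2"]
        by (simp add: f1_def f_def g_def)
    qed (simp add: f1_def)
  qed
  have "integral {0..1} g \<ge> 0"
    using gI by (rule has_integral_nonneg) (simp add: g_def)
  moreover have "integral {0..1} g \<noteq> 0"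
  proof
    assume "integral {0..1} g = 0"
    then have "g 0 = 0"
      using gI contg
      by (intro has_integral_0_cbox_imp_0[of 0 "1::real" g 0]) (auto simp: g_def box_real cbox_interval)
    then show False using coef_0 by (simp add: g_def phi_0)
  qed
  ultimately show ?thesis using le by linarith
qed

text \<open>
  The standard self-adjointness argument: at a non-real zero the Wronskian formula would give
  the square integral of \<open>phi(w s)\<close> the value \<open>0\<close>.
\<close>

lemma psi_zero_real:
  assumes "psi w = 0" shows "Im w = 0"
proof (rule ccontr)
  assume "Im w \<noteq> 0"
  then have "w \<noteq> cnj w" "w \<noteq> 0" by (auto simp: complex_eq_iff)
  then have "overlap w (cnj w) = 0"
    using assms by (simp add: overlap_def psi_cnj)
  with overlap_cnj_pos[OF \<open>w \<noteq> 0\<close>] show False by simp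
qed

lemma overlap_of_real:
  assumes "x \<noteq> 0"
  shows "overlap (of_real x) (of_real x) = of_real (((psi x)\<^sup>2 - (\<nu>\<^sup>2 - x) * (phi x)\<^sup>2) / x)"
    and "((psi x)\<^sup>2 - (\<nu>\<^sup>2 - x) * (phi x)\<^sup>2) / x > 0"
proof -
  show *: "overlap (of_real x) (of_real x) = of_real (((psi x)\<^sup>2 - (\<nu>\<^sup>2 - x) * (phi x)\<^sup>2) / x)"
    by (simp add: overlap_def phi_of_real psi_of_real)
  show "((psi x)\<^sup>2 - (\<nu>\<^sup>2 - x) * (phi x)\<^sup>2) / x > 0"
    using overlap_cnj_pos[of "of_real x"] assms unfolding complex_cnj_complex_of_real * by simp
qed

text \<open>
  A common zero would make the energy formula for the square integral vanish.
\<close>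

lemma no_common_zero:
  assumes "x \<noteq> 0" shows "phi x \<noteq> 0 \<or> psi (x::real) \<noteq> 0"
  using overlap_of_real(2)[OF assms] by auto

text \<open>
  Minus the residue of \<open>phi/psi\<close> at a zero \<open>x\<close> of \<open>psi\<close>; the system for \<open>psi'\<close> gives
  \<open>phi(x)/psi'(x) = 2 x/(\<nu>\<^sup>2 - x)\<close>.
\<close>

definition residue_weight :: "real \<Rightarrow> real" where
  "residue_weight x = 2 * x / (x - \<nu>\<^sup>2)"

text \<open>
  At a zero \<open>x\<close> of \<open>psi\<close> the energy formula for the square integral is \<open>2 (phi x)\<^sup>2\<close> divided by
  the weight. In classical terms, the positivity for \<open>x > 0\<close> says that the critical points of \<open>J\<^sub>\<nu>\<close>
  lie beyond \<open>-\<nu>\<close>.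
\<close>

lemma residue_weight_pos:
  assumes "x \<noteq> 0" "psi x = 0"
  shows "residue_weight x > 0"
proof -
  have "(x - \<nu>\<^sup>2) * (phi x)\<^sup>2 / x > 0"
    using overlap_of_real(2)[OF assms(1)] assms(2) by (simp add: left_diff_distrib diff_divide_distrib)
  then show ?thesis
    unfolding residue_weight_def by (auto simp: zero_less_divide_iff zero_less_mult_iff mult_less_0_iff)
qed

end

section \<open>Bessel's inequality\<close>

context bessel_order begin

text \<open>
  The functions \<open>phi(x s)\<close>, for zeros \<open>x\<close> of \<open>psi\<close>, are orthogonal with respect to the weight
  \<open>s\<^sup>\<nu>\<close>, so this is Bessel's inequality for \<open>phi(w s)\<close>. Completeness of the system is the
  corresponding equality; it is what the expansion into partial fractions supplies later.
\<close>

lemma bessel_inequality: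
  fixes A :: "real set"
  assumes fin: "finite A" and A: "\<And>x. x \<in> A \<Longrightarrow> x \<noteq> 0 \<and> psi x = 0" and w: "w \<noteq> 0"
  shows "(\<Sum>x\<in>A. (cmod (overlap w (of_real x)))\<^sup>2 / Re (overlap (of_real x) (of_real x)))
           \<le> Re (overlap w (cnj w))"
proof -
  define N where "N x = Re (overlap (of_real x) (of_real x))" for x
  have N: "overlap (of_real x) (of_real x) = of_real (N x)" "N x > 0" if "x \<in> A" for x
    using overlap_of_real[of x] A[OF that] by (simp_all add: N_def)
  define b where "b x = overlap w (of_real x) / of_real (N x)" for x
  define u where "u s = phi (w * of_real s) - (\<Sum>x\<in>A. b x * phi (of_real x * of_real s))" for s
  \<comment> \<open>\<open>u\<close> is \<open>phi(w s)\<close> minus its orthogonal projection; all integrals are bilinear here,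
    and conjugation enters through \<open>phi_cnj\<close>.\<close>
  have proj: "((\<lambda>s. (s powr \<nu>) *\<^sub>R (u s * phi (z * of_real s))) has_integral
         (overlap w z - (\<Sum>x\<in>A. b x * overlap (of_real x) z))) {0..1}" for z
  proof -
    have "((\<lambda>s. (s powr \<nu>) *\<^sub>R (phi (w * of_real s) * phi (z * of_real s))
         - (\<Sum>x\<in>A. b x * ((s powr \<nu>) *\<^sub>R (phi (of_real x * of_real s) * phi (z * of_real s)))))
       has_integral (overlap w z - (\<Sum>x\<in>A. b x * overlap (of_real x) z))) {0..1}"
      using fin w A
      by (intro has_integral_diff has_integral_sum has_integral_mult_right overlap_integral) auto
    moreover have "(s powr \<nu>) *\<^sub>R (phi (w * of_real s) * phi (z * of_real s))
         - (\<Sum>x\<in>A. b x * ((s powr \<nu>) *\<^sub>R (phi (of_real x * of_real s) * phi (z * of_real s))))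
        = (s powr \<nu>) *\<^sub>R (u s * phi (z * of_real s))" for s
      by (simp add: u_def left_diff_distrib scaleR_conv_of_real right_diff_distrib
            sum_distrib_right sum_distrib_left mult_ac)
    ultimately show ?thesis by simp
  qed
  have orth: "overlap (of_real y) (of_real x) = 0" if "x \<in> A" "y \<in> A" "x \<noteq> y" for x y
    using that A by (simp add: overlap_def psi_of_real)
  have zero: "overlap w (of_real x) - (\<Sum>y\<in>A. b y * overlap (of_real y) (of_real x)) = 0"
    if x: "x \<in> A" for x
  proof -
    have "(\<Sum>y\<in>A. b y * overlap (of_real y) (of_real x))
         = (\<Sum>y\<in>A. if y = x then b x * of_real (N x) else 0)"
      by (rule sum.cong) (use x orth N in auto)
    also have "\<dots> = overlap w (of_real x)"
      using x fin N(2)[OF x] by (simp add: b_def)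
    finally show ?thesis by simp
  qed
  have cnj_eq: "cnj (phi (z * of_real s)) = phi (cnj z * of_real s)" for z s
    using phi_cnj[of "z * of_real s"] by simp
  have cu: "cnj (u s) = phi (cnj w * of_real s) - (\<Sum>x\<in>A. cnj (b x) * phi (of_real x * of_real s))" for s
    by (simp only: u_def complex_cnj_diff cnj_sum complex_cnj_mult cnj_eq complex_cnj_complex_of_real)
  have "((\<lambda>s. (s powr \<nu>) *\<^sub>R (u s * phi (cnj w * of_real s))
       - (\<Sum>x\<in>A. cnj (b x) * ((s powr \<nu>) *\<^sub>R (u s * phi (of_real x * of_real s)))))
     has_integral ((overlap w (cnj w) - (\<Sum>x\<in>A. b x * overlap (of_real x) (cnj w)))
       - (\<Sum>x\<in>A. cnj (b x) * (overlap w (of_real x)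
               - (\<Sum>y\<in>A. b y * overlap (of_real y) (of_real x)))))) {0..1}"
    by (intro has_integral_diff has_integral_sum has_integral_mult_right proj fin)
  moreover have "(\<lambda>s. (s powr \<nu>) *\<^sub>R (u s * phi (cnj w * of_real s))
       - (\<Sum>x\<in>A. cnj (b x) * ((s powr \<nu>) *\<^sub>R (u s * phi (of_real x * of_real s)))))
      = (\<lambda>s. (s powr \<nu>) *\<^sub>R (u s * cnj (u s)))"
    by (rule ext) (simp add: cu right_diff_distrib scaleR_conv_of_real sum_distrib_left mult_ac)
  ultimately have "((\<lambda>s. (s powr \<nu>) *\<^sub>R (u s * cnj (u s))) has_integral
       (overlap w (cnj w) - (\<Sum>x\<in>A. b x * overlap (of_real x) (cnj w)))) {0..1}"
    by (simp add: zero)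
  from has_integral_linear[OF this bounded_linear_Re]
  have "0 \<le> Re (overlap w (cnj w) - (\<Sum>x\<in>A. b x * overlap (of_real x) (cnj w)))"
    by (rule has_integral_nonneg) (simp add: complex_mult_cnj)
  moreover have "b x * overlap (of_real x) (cnj w) = of_real ((cmod (overlap w (of_real x)))\<^sup>2 / N x)" for x
  proof -
    have "overlap (of_real x) (cnj w) = cnj (overlap w (of_real x))"
      using cnj_overlap[of "of_real x" w] overlap_sym[of "of_real x" w] by simp
    then show ?thesis
      by (simp add: b_def complex_mult_cnj cmod_power2)
  qed
  ultimately show ?thesis by (simp add: N_def)
qed

lemma Im_residue: "Im (of_real r / (w - of_real x)) = - r * Im w / (cmod (w - of_real x))\<^sup>2"
  by (simp add: Im_divide cmod_power2)

text \<open>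
  Bessel's inequality in terms of \<open>phi/psi\<close>. Its left side turns into the imaginary parts of
  the polar parts and its right side into that of the quotient. So the imaginary part of
  \<open>phi/psi\<close> has the sign of \<open>Im w\<close>, and keeps it when polar parts are subtracted.
\<close>

lemma quotient_typically_real:
  fixes A :: "real set"
  assumes fin: "finite A" and A: "\<And>x. x \<in> A \<Longrightarrow> x \<noteq> 0 \<and> psi x = 0" and w: "Im w \<noteq> 0"
  shows "0 \<le> Im w * Im (phi w / psi w + (\<Sum>x\<in>A. of_real (residue_weight x) / (w - of_real x)))"
proof -
  have nz: "psi w \<noteq> 0" using psi_zero_real w by blast
  have w0: "w \<noteq> 0" and wc: "w \<noteq> cnj w" and wr: "w \<noteq> of_real x" for x
    using w by (auto simp: complex_eq_iff)
  have term_eq: "(cmod (overlap w (of_real x)))\<^sup>2 / Re (overlap (of_real x) (of_real x))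
      = 2 * (cmod (psi w))\<^sup>2 * (residue_weight x / (cmod (w - of_real x))\<^sup>2)" if "x \<in> A" for x
  proof -
    have x: "x \<noteq> 0" "psi x = 0" using A[OF that] by auto
    have "phi x \<noteq> 0" using no_common_zero[OF x(1)] x(2) by blast
    have "cmod (overlap w (of_real x)) = 2 * cmod (psi w) * \<bar>phi x\<bar> / cmod (w - of_real x)"
      using wr x by (simp add: overlap_def psi_of_real phi_of_real norm_mult norm_divide)
    moreover have "Re (overlap (of_real x) (of_real x)) = (x - \<nu>\<^sup>2) * (phi x)\<^sup>2 / x"
      using overlap_of_real(1)[OF x(1)] x(2) by (simp add: left_diff_distrib diff_divide_distrib)
    ultimately show ?thesis
      using \<open>phi x \<noteq> 0\<close> by (simp add: residue_weight_def power_divide power_mult_distrib)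
  qed
  have "overlap w (cnj w) = of_real (2 * (cmod (psi w))\<^sup>2 * Im (phi w / psi w) / Im w)"
  proof -
    define p where "p = phi w / psi w"
    have p: "phi w = p * psi w" using nz by (simp add: p_def)
    have "overlap w (cnj w) = 2 * ((p - cnj p) * (psi w * cnj (psi w))) / (w - cnj w)"
      using wc by (simp add: overlap_def psi_cnj phi_cnj p algebra_simps)
    also have "\<dots> = of_real (2 * (cmod (psi w))\<^sup>2 * Im p / Im w)"
      using w by (simp add: complex_diff_cnj complex_mult_cnj cmod_power2 field_simps)
    finally show ?thesis by (simp add: p_def)
  qed
  then have "2 * (cmod (psi w))\<^sup>2 * (\<Sum>x\<in>A. residue_weight x / (cmod (w - of_real x))\<^sup>2)
      \<le> 2 * (cmod (psi w))\<^sup>2 * (Im (phi w / psi w) / Im w)"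
    using bessel_inequality[OF fin A w0] by (simp add: term_eq sum_distrib_left cong: sum.cong)
  moreover have "0 < 2 * (cmod (psi w))\<^sup>2" using nz by simp
  ultimately have "(\<Sum>x\<in>A. residue_weight x / (cmod (w - of_real x))\<^sup>2) \<le> Im (phi w / psi w) / Im w"
    by (rule mult_left_le_imp_le)
  then have "(Im w)\<^sup>2 * (\<Sum>x\<in>A. residue_weight x / (cmod (w - of_real x))\<^sup>2)
      \<le> (Im w)\<^sup>2 * (Im (phi w / psi w) / Im w)"
    by (intro mult_left_mono) auto
  also have "\<dots> = Im w * Im (phi w / psi w)" using w by (simp add: power2_eq_square)
  finally have "(Im w)\<^sup>2 * (\<Sum>x\<in>A. residue_weight x / (cmod (w - of_real x))\<^sup>2)
      \<le> Im w * Im (phi w / psi w)" .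
  moreover have "Im w * Im (\<Sum>x\<in>A. of_real (residue_weight x) / (w - of_real x))
      = - ((Im w)\<^sup>2 * (\<Sum>x\<in>A. residue_weight x / (cmod (w - of_real x))\<^sup>2))"
    by (simp add: Im_residue sum_distrib_left sum_negf power2_eq_square mult_ac)
  ultimately show ?thesis by (simp add: distrib_left)
qed

end

section \<open>Holomorphic functions on a disc\<close>

text \<open>
  A Harnack inequality: the Cayley transform \<open>(p - p(0))/(p + cnj p(0))\<close> maps the disc into
  the unit disc and fixes \<open>0\<close>, so Schwarz's lemma applies.
\<close>

lemma positive_real_part_bound:
  assumes hol: "p holomorphic_on ball 0 R" and R: "0 < R"
    and pos: "\<And>z. cmod z < R \<Longrightarrow> 0 \<le> Re (p z)" and w: "cmod w < R"
  shows "cmod (p w - p 0) * (R - cmod w) \<le> 2 * Re (p 0) * cmod w"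
proof -
  \<comment> \<open>Adding \<open>\<epsilon>\<close> makes the real part positive, which keeps the Cayley transform defined.\<close>
  have *: "cmod (p w - p 0) * (R - cmod w) \<le> 2 * Re (p 0) * cmod w + \<epsilon> * (2 * cmod w)"
    if e: "\<epsilon> > 0" for \<epsilon>
  proof -
    define P where "P z = p (of_real R * z) + of_real \<epsilon>" for z
    have in_ball: "of_real R * z \<in> ball 0 R" if "z \<in> ball 0 1" for z :: complex
      using that R by (simp add: norm_mult)
    have rP: "0 < Re (P z)" if "cmod z < 1" for z
      using pos[of "of_real R * z"] in_ball[of z] that e by (simp add: P_def norm_mult)
    have ne: "P z + cnj (P 0) \<noteq> 0" if "cmod z < 1" for z
    proof
      assume "P z + cnj (P 0) = 0"
      then have "Re (P z) + Re (P 0) = 0" by (metis complex_cnj(1) plus_complex.sel(1) zero_complex.sel(1) complex.collapse complex.sel(1))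
      then show False using rP[OF that] rP[of 0] by simp
    qed
    have holP: "P holomorphic_on ball 0 1"
      unfolding P_def
      by (intro holomorphic_intros holomorphic_on_compose_gen[OF _ hol, unfolded o_def])
         (use in_ball in auto)
    define F where "F z = (P z - P 0) / (P z + cnj (P 0))" for z
    have lt: "cmod (F z) < 1" if z: "cmod z < 1" for z
    proof -
      have "(cmod (P z - P 0))\<^sup>2 < (cmod (P z + cnj (P 0)))\<^sup>2"
        using mult_pos_pos[OF rP[OF z] rP[of 0]] unfolding cmod_power2
        by (simp add: power2_eq_square algebra_simps)
      then have "cmod (P z - P 0) < cmod (P z + cnj (P 0))"
        by (rule power2_less_imp_less) simp
      then show ?thesis using ne[OF z] by (simp add: F_def norm_divide)
    qed
    define z where "z = w / of_real R"
    have z: "cmod z < 1" "of_real R * z = w" "cmod z = cmod w / R"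
      using w R by (simp_all add: z_def norm_divide)
    have "cmod (F z) \<le> cmod z"
    proof (rule Schwarz_Lemma)
      show "F holomorphic_on ball 0 1"
        unfolding F_def by (intro holomorphic_intros holP) (use ne in auto)
    qed (use lt z in \<open>auto simp: F_def\<close>)
    then have "cmod (P z - P 0) \<le> cmod z * cmod (P z + cnj (P 0))"
      using ne[OF z(1)] by (simp add: F_def norm_divide divide_le_eq)
    also have "P z + cnj (P 0) = (P z - P 0) + of_real (2 * Re (P 0))"
      by (simp add: complex_eq_iff)
    also have "cmod z * cmod \<dots> \<le> cmod z * (cmod (P z - P 0) + 2 * Re (P 0))"
    proof -
      have "cmod (complex_of_real (2 * Re (P 0))) = 2 * Re (P 0)"
        using rP[of 0] by (simp only: norm_of_real) simp
      then show ?thesis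
        by (metis mult_left_mono norm_ge_zero norm_triangle_ineq)
    qed
    also have "P z - P 0 = p w - p 0" by (simp add: P_def z(2))
    also have "Re (P 0) = Re (p 0) + \<epsilon>" by (simp add: P_def)
    finally show ?thesis using R by (simp add: z(3) field_simps)
  qed
  show ?thesis
  proof (rule field_le_epsilon)
    fix \<epsilon> :: real assume e: "\<epsilon> > 0"
    have "\<epsilon> / (2 * R) * (2 * cmod w) = \<epsilon> * (cmod w / R)" by simp
    also have "\<dots> \<le> \<epsilon> * 1"
      using w R e by (intro mult_left_mono) auto
    finally show "cmod (p w - p 0) * (R - cmod w) \<le> 2 * Re (p 0) * cmod w + \<epsilon>"
      using *[of "\<epsilon> / (2 * R)"] e R by simp
  qed
qed

text \<open>
  This quantifies why an entire function that is real on the real line and has nonnegative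
  imaginary part on the upper half plane is linear: as \<open>R\<close> grows, only the linear part survives. Following
  Rogosinski, the sign condition on the circle \<open>\<bar>w\<bar> = R\<close> says exactly that
  \<open>p(w) = (R\<^sup>2 - w\<^sup>2) (h(w) - h(0))/w\<close> has nonnegative real part there, since
  \<open>(R\<^sup>2 - w\<^sup>2)/w = cnj w - w\<close> is purely imaginary on the circle. The maximum principle and the
  preceding bound then control \<open>p\<close> inside. The sign condition is required off the real axis only,
  where it is known for quotients with poles on the real line.
\<close>

lemma typically_real_remainder:
  assumes hol: "h holomorphic_on ball 0 R'" and R: "0 < R" "R < R'"
    and h0: "Im (h 0) = 0" and d0: "Im (deriv h 0) = 0"
    and pos: "\<And>w. cmod w = R \<Longrightarrow> Im w \<noteq> 0 \<Longrightarrow> 0 \<le> Im w * Im (h w)"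
  shows "0 \<le> Re (deriv h 0)"
    and "\<And>w. cmod w \<le> R / 2 \<Longrightarrow> cmod (h w - h 0 - w * deriv h 0) \<le> 6 * Re (deriv h 0) * (cmod w)\<^sup>2 / R"
proof -
  define k where "k z = (if z = 0 then deriv h 0 else (h z - h 0) / (z - 0))" for z
  have holk: "k holomorphic_on ball 0 R'"
    unfolding k_def using R by (intro pole_lemma hol) auto
  define p where "p z = ((of_real R)\<^sup>2 - z\<^sup>2) * k z" for z
  have holp: "p holomorphic_on ball 0 R'"
    unfolding p_def by (intro holomorphic_intros holk)
  have bd: "0 \<le> Re (p w)" if w: "cmod w = R" for w
  proof -
    have w0: "w \<noteq> 0" using w R by auto
    have "(of_real R)\<^sup>2 = w * cnj w"
      using w by (simp add: complex_norm_square[symmetric])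
    then have "p w = (w * (cnj w - w)) * ((h w - h 0) / w)"
      using w0 by (simp add: p_def k_def power2_eq_square right_diff_distrib)
    then have "p w = (cnj w - w) * (h w - h 0)"
      using w0 by simp
    then have "Re (p w) = 2 * (Im w * Im (h w))"
      using h0 by simp
    then show ?thesis using pos[OF w] by (cases "Im w = 0") auto
  qed
  have rp: "0 \<le> Re (p w)" if w: "cmod w < R" for w
  proof -
    have "Re (- p w) \<le> 0"
    proof (rule maximum_real_frontier[of "\<lambda>z. - p z" "cball 0 R"])
      show "(\<lambda>z. - p z) holomorphic_on interior (cball 0 R)"
        using R by (intro holomorphic_intros holomorphic_on_subset[OF holp]) auto
      show "continuous_on (closure (cball 0 R)) (\<lambda>z. - p z)"
        using R by (intro holomorphic_on_imp_continuous_on holomorphic_intros holomorphic_on_subset[OF holp]) auto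
    qed (use w bd in \<open>auto simp: frontier_def\<close>)
    then show ?thesis by simp
  qed
  define c where "c = Re (deriv h 0)"
  have dc: "deriv h 0 = of_real c" using d0 by (simp add: c_def complex_eq_iff)
  have p0: "p 0 = of_real (R\<^sup>2 * c)" by (simp add: p_def k_def dc)
  show c0: "0 \<le> Re (deriv h 0)"
    using rp[of 0] R by (simp add: p0 c_def[symmetric] zero_le_mult_iff)
  fix w assume w: "cmod w \<le> R / 2"
  have wR: "cmod w < R" using w R by simp
  define D where "D = cmod (k w - of_real c)"
  define x where "x = cmod w"
  have x: "0 \<le> x" "x \<le> R / 2" using w by (simp_all add: x_def)
  have c: "0 \<le> c" using c0 by (simp add: c_def)
  have "cmod (p w - p 0) * (R - x) \<le> 2 * Re (p 0) * x"
    unfolding x_def using R wR rp by (intro positive_real_part_bound holomorphic_on_subset[OF holp]) auto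
  moreover have "cmod (p w - p 0) * (R / 2) \<le> cmod (p w - p 0) * (R - x)"
    using x by (intro mult_left_mono) auto
  ultimately have "cmod (p w - p 0) * (R / 2) \<le> 2 * (R\<^sup>2 * c) * x"
    by (simp add: p0)
  then have 1: "cmod (p w - p 0) \<le> 4 * R * c * x"
    using R by (simp add: power2_eq_square field_simps)
  have "((of_real R)\<^sup>2 - w\<^sup>2) * (k w - of_real c) = (p w - p 0) + w\<^sup>2 * of_real c"
    by (simp add: p_def p0 k_def dc algebra_simps)
  then have "cmod ((of_real R)\<^sup>2 - w\<^sup>2) * D \<le> cmod (p w - p 0) + x\<^sup>2 * c"
    unfolding D_def x_def using norm_triangle_ineq[of "p w - p 0" "w\<^sup>2 * of_real c"] c
    by (simp add: norm_mult[symmetric] norm_power) (simp add: norm_mult norm_power)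
  moreover have "3 / 4 * R\<^sup>2 \<le> cmod ((of_real R)\<^sup>2 - w\<^sup>2)"
  proof -
    have "x\<^sup>2 \<le> (R / 2)\<^sup>2" using x by (intro power_mono) auto
    moreover have "R\<^sup>2 - x\<^sup>2 \<le> cmod ((of_real R)\<^sup>2 - w\<^sup>2)"
      using norm_triangle_ineq2[of "(of_real R)\<^sup>2" "w\<^sup>2"] by (simp add: norm_power x_def)
    ultimately show ?thesis by (simp add: power2_eq_square)
  qed
  ultimately have "3 / 4 * R\<^sup>2 * D \<le> 4 * R * c * x + x\<^sup>2 * c"
    using 1 mult_right_mono[of "3 / 4 * R\<^sup>2" "cmod ((of_real R)\<^sup>2 - w\<^sup>2)" D]
    by (simp add: D_def)
  also have "x\<^sup>2 * c \<le> R / 2 * x * c"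
    using x c mult_right_mono[of "2 * x" R "x * c"] by (simp add: power2_eq_square mult_ac)
  finally have "R * (3 / 4 * R * D) \<le> R * (9 / 2 * c * x)"
    by (simp add: power2_eq_square algebra_simps)
  then have "3 / 4 * R * D \<le> 9 / 2 * c * x"
    using R by (simp only: mult_le_cancel_left_pos)
  then have "D \<le> 6 * c * x / R" using R by (simp add: field_simps)
  then have "x * D \<le> x * (6 * c * x / R)" using x by (intro mult_left_mono) auto
  moreover have "h w - h 0 - w * deriv h 0 = w * (k w - of_real c)"
    by (simp add: k_def dc right_diff_distrib[of w _ "of_real c"])
  ultimately show "cmod (h w - h 0 - w * deriv h 0) \<le> 6 * Re (deriv h 0) * (cmod w)\<^sup>2 / R"
    by (simp add: norm_mult D_def x_def c_def power2_eq_square mult_ac)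
qed

lemma holomorphic_extend_finite:
  fixes f :: "complex \<Rightarrow> complex"
  assumes "finite Z" and "open S" and "f holomorphic_on S - Z"
    and "\<And>z. z \<in> Z \<Longrightarrow> z \<in> S \<Longrightarrow> ((\<lambda>w. (w - z) * f w) \<longlongrightarrow> 0) (at z)"
  shows "\<exists>g. g holomorphic_on S \<and> (\<forall>w\<in>S - Z. g w = f w)"
  using assms
proof (induction Z arbitrary: f rule: finite_induct)
  case empty
  then show ?case by auto
next
  case (insert z Z)
  have op: "open (S - Z)"
    using insert.prems(1) insert.hyps(1) by (simp add: open_Diff finite_imp_closed)
  show ?case
  proof (cases "z \<in> S")
    case False
    then have eq: "S - insert z Z = S - Z" by auto
    show ?thesis
      unfolding eq
    proof (rule insert.IH)
      show "f holomorphic_on S - Z" using insert.prems(2) by (simp only: eq)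
      show "((\<lambda>w. (w - y) * f w) \<longlongrightarrow> 0) (at y)" if "y \<in> Z" "y \<in> S" for y
        using that by (intro insert.prems(3)) auto
    qed (rule insert.prems(1))
  next
    case True
    then have zi: "z \<in> interior (S - Z)"
      using op insert.hyps(2) by (simp add: interior_open)
    have "f holomorphic_on (S - Z) - {z}"
      using insert.prems(2) by (rule back_subst[where P = "\<lambda>A. f holomorphic_on A"]) auto
    from holomorphic_on_extend_lim[OF this zi]
    have "\<exists>g. g holomorphic_on S - Z \<and> (\<forall>w\<in>S - Z - {z}. g w = f w)"
      using insert.prems(3)[OF _ True] by simp
    then obtain g where g: "g holomorphic_on S - Z" "\<And>w. w \<in> S - Z - {z} \<Longrightarrow> g w = f w"
      by blast
    have "\<exists>h. h holomorphic_on S \<and> (\<forall>w\<in>S - Z. h w = g w)"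
    proof (rule insert.IH[OF insert.prems(1) g(1)])
      fix y assume y: "y \<in> Z" "y \<in> S"
      have "open (S - ((Z - {y}) \<union> {z}))"
        using insert.prems(1) insert.hyps(1) by (intro open_Diff finite_imp_closed) auto
      moreover have "y \<in> S - ((Z - {y}) \<union> {z})" using y insert.hyps(2) by auto
      ultimately have "\<forall>\<^sub>F w in at y. w \<in> S - ((Z - {y}) \<union> {z}) \<and> w \<noteq> y"
        using eventually_at_topological by blast
      then have ev: "\<forall>\<^sub>F w in at y. (w - y) * f w = (w - y) * g w"
        by eventually_elim (use g(2) in auto)
      have "((\<lambda>w. (w - y) * f w) \<longlongrightarrow> 0) (at y)"
        by (rule insert.prems(3)) (use y in auto)
      then show "((\<lambda>w. (w - y) * g w) \<longlongrightarrow> 0) (at y)"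
        using ev by (rule Lim_transform_eventually)
    qed
    then obtain h where h: "h holomorphic_on S" "\<And>w. w \<in> S - Z \<Longrightarrow> h w = g w" by blast
    show ?thesis
    proof (intro exI[of _ h] conjI ballI h(1))
      show "h w = f w" if "w \<in> S - insert z Z" for w
        using h(2)[of w] g(2)[of w] that by simp
    qed
  qed
qed

section \<open>Zeros of the denominator and removal of poles\<close>

context bessel_order begin

lemma coef_sign: "(- 1) ^ m * coef m > 0"
proof -
  have "(- 1) ^ m * coef m = (1 / 4) ^ m / fact m * rGamma (\<nu> + real m + 1)"
    by (simp add: coef_def power_mult_distrib[symmetric])
  then show ?thesis using rGamma_shift_pos[of m] by simp
qed

lemma coef_power: "coef m * x ^ m = (- 1) ^ m * coef m * (- x) ^ m"
  by (cases "even m") (auto simp: power_minus_odd)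

lemma coef_power_nonneg: "x \<le> 0 \<Longrightarrow> coef m * x ^ m \<ge> 0"
  unfolding coef_power using coef_sign[of m] by simp

lemma phi_pos:
  fixes x :: real assumes "x \<le> 0" shows "phi x > 0"
proof -
  have s: "(\<lambda>m. coef m * x ^ m) sums phi x"
    unfolding phi_def using power_series_sums[OF everywhere_convergent_coef, of x] by simp
  have "0 < coef 0 * x ^ 0" using coef_0 by simp
  also have "\<dots> \<le> suminf (\<lambda>m. coef m * x ^ m)"
    using sum_le_suminf[OF sums_summable[OF s], of "{0}"] coef_power_nonneg[OF assms] by simp
  finally show ?thesis using sums_unique[OF s] by simp
qed

lemma psi_ge:
  fixes x :: real assumes "x \<le> 0"
  shows "psi x \<ge> \<nu> * coef 0 + (2 + \<nu>) * coef 1 * x"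
proof -
  have s: "(\<lambda>m. (2 * real m + \<nu>) * coef m * x ^ m) sums psi x"
    unfolding psi_def using power_series_sums[OF everywhere_convergent_coef2, of x] by simp
  have "(\<Sum>m\<in>{0,1}. (2 * real m + \<nu>) * coef m * x ^ m) \<le> suminf (\<lambda>m. (2 * real m + \<nu>) * coef m * x ^ m)"
  proof (rule sum_le_suminf[OF sums_summable[OF s]])
    fix m :: nat assume "m \<in> - {0, 1}"
    then have "2 * real m + \<nu> \<ge> 0" using order_gt by (cases m) auto
    then show "0 \<le> (2 * real m + \<nu>) * coef m * x ^ m"
      using coef_power_nonneg[OF assms, of m] by (simp add: mult.assoc)
  qed simp
  then show ?thesis using sums_unique[OF s] by simp
qed

lemma psi'_neg:
  fixes x :: real assumes "x < 0" shows "psi' x < 0"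
proof -
  let ?t = "\<lambda>m. diffs (\<lambda>m. (2 * real m + \<nu>) * coef m) m * x ^ m"
  have s: "?t sums psi' x"
    unfolding psi'_def
    using power_series_sums[OF everywhere_convergent_diffs[OF everywhere_convergent_coef2], of x] by simp
  have neg: "- ?t m > 0" for m
  proof -
    have "- ?t m = real (Suc m) * (2 * real (Suc m) + \<nu>) * ((- 1) ^ Suc m * coef (Suc m)) * (- x) ^ m"
      by (cases "even m") (auto simp: diffs_def power_minus_odd)
    moreover have "2 * real (Suc m) + \<nu> > 0" "(- x) ^ m > 0"
      using order_gt assms by simp_all
    ultimately show ?thesis
      using coef_sign[of "Suc m"] by (simp only: mult_pos_pos of_nat_0_less_iff zero_less_Suc)
  qed
  have "0 < suminf (\<lambda>m. - ?t m)"
    by (rule suminf_pos[OF sums_summable[OF sums_minus[OF s]] neg])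
  then show ?thesis using sums_unique[OF sums_minus[OF s]] by simp
qed

lemma psi_strict_antimono:
  fixes x y :: real assumes "x < y" "y \<le> 0" shows "psi y < psi x"
proof (rule DERIV_neg_imp_decreasing_open[OF assms(1)])
  show "\<exists>d. (psi has_real_derivative d) (at z) \<and> d < 0" if "x < z" "z < y" for z
    using psi_deriv[of z] psi'_neg[of z] that assms by auto
  show "continuous_on {x..y} psi"
    using psi_deriv DERIV_isCont continuous_at_imp_continuous_on by blast
qed

lemma psi_0_neg: "psi (0::real) < 0"
  using coef_0 order_neg by (simp add: psi_0 mult_less_0_iff)

text \<open>
  All coefficients of \<open>psi(- y)\<close> except the constant one have the sign opposite to it, so that
  \<open>psi\<close> decreases on the negative axis and changes sign exactly once: the zero of \<open>I\<^sub>\<nu>'\<close>.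
\<close>

lemma negative_zero:
  "\<exists>b>0. psi (- b :: real) = 0 \<and> (\<forall>x\<le>0. psi x = 0 \<longrightarrow> x = - b) \<and> (\<forall>x. x < - b \<longrightarrow> psi x > 0)"
proof -
  \<comment> \<open>The zero of the linear part of the series; the zero of \<open>psi\<close> lies between it and \<open>0\<close>.\<close>
  define y where "y = \<nu> * coef 0 / (- ((2 + \<nu>) * coef 1))"
  have c1: "coef 1 < 0" using coef_sign[of 1] by simp
  have d: "(2 + \<nu>) * coef 1 < 0" using c1 order_gt by (intro mult_pos_neg) auto
  have y: "y < 0"
    unfolding y_def using d coef_0 order_neg by (intro divide_neg_pos mult_neg_pos) auto
  have y': "\<nu> * coef 0 + (2 + \<nu>) * coef 1 * y = 0"
  proof -
    have "p + q * (p / - q) = 0" if "q < 0" for p q :: real using that by simp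
    from this[OF d] show ?thesis unfolding y_def .
  qed
  have "\<exists>x. y \<le> x \<and> x \<le> 0 \<and> psi x = 0"
  proof (rule IVT2')
    show "continuous_on {y..0} psi"
      using psi_deriv DERIV_isCont continuous_at_imp_continuous_on by blast
  qed (use psi_ge[of y] y y' psi_0_neg in auto)
  then obtain x :: real where x: "x \<le> 0" "psi x = 0" by blast
  have "x \<noteq> 0" using x psi_0_neg by auto
  have unique: "z = x" if "z \<le> 0" "psi z = 0" for z
  proof (rule ccontr)
    assume "z \<noteq> x"
    then consider "z < x" | "x < z" by linarith
    then show False
      using psi_strict_antimono[of z x] psi_strict_antimono[of x z] that x by cases auto
  qed
  show ?thesis
  proof (intro exI[of _ "- x"] conjI allI impI)
    show "0 < - x" using x \<open>x \<noteq> 0\<close> by simp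
    show "psi (- (- x)) = 0" using x by simp
    show "z = - (- x)" if "z \<le> 0" "psi z = 0" for z using unique that by simp
    show "psi z > 0" if "z < - (- x)" for z
      using psi_strict_antimono[of z x] that x by simp
  qed
qed

lemma holomorphic_phi: "phi holomorphic_on S"
proof -
  have "phi holomorphic_on UNIV"
    using holomorphic_on_open[OF open_UNIV] phi_deriv by blast
  then show ?thesis by (rule holomorphic_on_subset) simp
qed

lemma holomorphic_psi: "psi holomorphic_on S"
proof -
  have "psi holomorphic_on UNIV"
    using holomorphic_on_open[OF open_UNIV] psi_deriv by blast
  then show ?thesis by (rule holomorphic_on_subset) simp
qed

lemma finite_psi_zeros: "finite {x::real. \<bar>x\<bar> \<le> r \<and> psi x = 0}"
proof -
  have "\<not> (psi :: complex \<Rightarrow> complex) constant_on UNIV"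
  proof
    assume "(psi :: complex \<Rightarrow> complex) constant_on UNIV"
    then obtain c where c: "\<And>z. psi z = (c::complex)" by (auto simp: constant_on_def)
    obtain b where "psi (- b :: real) = 0" using negative_zero by blast
    then have "c = 0"
      using c[of "of_real (- b)"] psi_of_real[of "- b", where 'a = complex] by (simp only: of_real_0)
    then have "psi (of_real 0) = (of_real 0 :: complex)" using c by simp
    then show False
      using psi_0_neg by (simp only: psi_of_real of_real_eq_iff)
  qed
  then have "finite {z \<in> cball 0 r. psi z = (0::complex)}"
    by (intro holomorphic_compact_finite_zeros[OF holomorphic_psi]) auto
  then have "finite (of_real -` {z \<in> cball 0 r. psi z = (0::complex)} :: real set)"
    by (rule finite_vimageI) (simp add: inj_of_real)
  moreover have "of_real -` {z \<in> cball 0 r. psi z = (0::complex)} = {x::real. \<bar>x\<bar> \<le> r \<and> psi x = 0}"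
    by (auto simp: psi_of_real)
  ultimately show ?thesis by simp
qed

text \<open>
  The poles of \<open>phi/psi\<close> are simple with residues \<open>- residue_weight\<close>, so the polar parts cancel
  them all in the disc.
\<close>

lemma pole_free_part:
  fixes A :: "real set"
  assumes fin: "finite A" and A: "\<And>x. x \<in> A \<Longrightarrow> x \<noteq> 0 \<and> psi x = 0"
    and all: "\<And>x. \<bar>x\<bar> < r \<Longrightarrow> psi x = 0 \<Longrightarrow> x \<in> A"
  obtains H where "H holomorphic_on ball 0 r"
    "\<And>w. cmod w < r \<Longrightarrow> psi w \<noteq> 0 \<Longrightarrow>
       H w = phi w / psi w + (\<Sum>x\<in>A. of_real (residue_weight x) / (w - of_real x))"
proof -
  let ?m = "\<lambda>w. phi w / psi w + (\<Sum>x\<in>A. of_real (residue_weight x) / (w - of_real x))"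
  let ?Z = "complex_of_real ` A"
  have zeros: "psi w \<noteq> 0" if "cmod w < r" "w \<notin> ?Z" for w
  proof
    assume "psi w = 0"
    then have x: "w = of_real (Re w)" using psi_zero_real[of w] by (simp add: complex_eq_iff)
    then have "psi (Re w) = 0"
      using \<open>psi w = 0\<close> by (metis psi_of_real of_real_eq_0_iff)
    moreover have "\<bar>Re w\<bar> < r" using that(1) abs_Re_le_cmod[of w] by linarith
    ultimately have "Re w \<in> A" by (rule all[rotated])
    then have "w \<in> ?Z" by (subst x) (rule imageI)
    then show False using that(2) by contradiction
  qed
  have "\<exists>g. g holomorphic_on ball 0 r \<and> (\<forall>w\<in>ball 0 r - ?Z. g w = ?m w)"
  proof (rule holomorphic_extend_finite)
    show "finite ?Z" using fin by simp
    show "?m holomorphic_on ball 0 r - ?Z"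
      by (intro holomorphic_intros holomorphic_phi holomorphic_psi) (use zeros in auto)
    fix z assume "z \<in> ?Z"
    then obtain a where a: "a \<in> A" and z: "z = of_real a" by auto
    have a0: "a \<noteq> 0" "psi a = 0" using A[OF a] by auto
    have pa: "phi a \<noteq> 0" using no_common_zero[OF a0(1)] a0(2) by blast
    have ra: "residue_weight a > 0" using residue_weight_pos a0 by blast
    then have an: "a \<noteq> \<nu>\<^sup>2" by (auto simp: residue_weight_def)
    have pz: "psi z = 0" using a0 by (simp add: z psi_of_real)
    have psys: "2 * z * psi' z = of_real ((\<nu>\<^sup>2 - a) * phi a)"
      using psi_system[of z] pz by (simp add: z phi_of_real)
    then have d: "psi' z \<noteq> 0" using an pa by (auto simp del: of_real_mult of_real_diff)
    have l: "phi z / psi' z = - of_real (residue_weight a)"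
    proof -
      have "(\<nu>\<^sup>2 - a) * residue_weight a = - 2 * a"
        using an by (simp add: residue_weight_def field_simps)
      then have "of_real ((\<nu>\<^sup>2 - a) * residue_weight a) = - 2 * z"
        by (simp only: z) simp
      then have "of_real (\<nu>\<^sup>2 - a) * phi z + of_real ((\<nu>\<^sup>2 - a) * residue_weight a) * psi' z = 0"
        using psys by (simp only: z phi_of_real) simp
      then have "of_real (\<nu>\<^sup>2 - a) * (phi z + of_real (residue_weight a) * psi' z) = 0"
        by (simp add: distrib_left mult.assoc)
      then have "phi z + of_real (residue_weight a) * psi' z = 0"
        using an by (metis mult_eq_0_iff of_real_eq_0_iff right_minus_eq)
      then have "phi z = - of_real (residue_weight a) * psi' z"
        by (simp only: add_eq_0_iff2 mult_minus_left)
      then show ?thesis using d by simp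
    qed
    have "((\<lambda>w. phi w / ((psi w - psi z) / (w - z))) \<longlongrightarrow> phi z / psi' z) (at z)"
      using psi_deriv[of z] DERIV_isCont[OF phi_deriv[of z]] d
      by (intro tendsto_divide) (auto simp: has_field_derivative_iff isCont_def)
    then have t1: "((\<lambda>w. (w - z) * (phi w / psi w)) \<longlongrightarrow> - of_real (residue_weight a)) (at z)"
      by (simp add: pz l mult_ac)
    have "((\<lambda>w. (w - z) * (of_real (residue_weight x) / (w - of_real x))) \<longlongrightarrow>
        (if x = a then of_real (residue_weight a) else 0)) (at z)" for x
    proof (cases "x = a")
      case True
      have "\<forall>\<^sub>F w in at z. of_real (residue_weight a) = (w - z) * (of_real (residue_weight x) / (w - of_real x))"
        using True by (auto simp: eventually_at_filter z)
      from Lim_transform_eventually[OF tendsto_const this] show ?thesis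
        using True by simp
    next
      case False
      then have "((\<lambda>w. (w - z) * (of_real (residue_weight x) / (w - of_real x))) \<longlongrightarrow>
        (z - z) * (of_real (residue_weight x) / (z - of_real x))) (at z)"
        by (intro tendsto_intros) (auto simp: z)
      then show ?thesis using False by simp
    qed
    then have "((\<lambda>w. \<Sum>x\<in>A. (w - z) * (of_real (residue_weight x) / (w - of_real x))) \<longlongrightarrow>
        (\<Sum>x\<in>A. if x = a then of_real (residue_weight a) else 0)) (at z)"
      by (rule tendsto_sum)
    from tendsto_add[OF t1 this]
    show "((\<lambda>w. (w - z) * ?m w) \<longlongrightarrow> 0) (at z)"
      using a fin by (simp add: distrib_left sum_distrib_left)
  qed simp
  then obtain H where H: "H holomorphic_on ball 0 r" "\<And>w. w \<in> ball 0 r - ?Z \<Longrightarrow> H w = ?m w"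
    by blast
  show ?thesis
  proof (rule that[OF H(1)])
    show "H w = ?m w" if "cmod w < r" "psi w \<noteq> 0" for w
    proof (rule H(2))
      have "psi (of_real x) = (0::complex)" if "x \<in> A" for x
        using A[OF that] by (simp add: psi_of_real)
      then have "w \<notin> ?Z" using \<open>psi w \<noteq> 0\<close> by blast
      then show "w \<in> ball 0 r - ?Z" using \<open>cmod w < r\<close> by simp
    qed
  qed
qed

end

section \<open>The expansion into partial fractions\<close>

context bessel_order begin

lemma phi'_of_real: "phi' (of_real x) = of_real (phi' x)"
  unfolding phi'_def
  by (rule power_series_of_real[OF everywhere_convergent_diffs[OF everywhere_convergent_coef]])

lemma psi'_of_real: "psi' (of_real x) = of_real (psi' x)"
  unfolding psi'_def
  by (rule power_series_of_real[OF everywhere_convergent_diffs[OF everywhere_convergent_coef2]])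

text \<open>
  The quotient \<open>phi/psi\<close> without the poles in \<open>A\<close>, and its derivative, on the real line.
\<close>

definition pole_free_quotient :: "real set \<Rightarrow> real \<Rightarrow> real" where
  "pole_free_quotient A x = phi x / psi x + (\<Sum>y\<in>A. residue_weight y / (x - y))"

definition pole_free_quotient' :: "real set \<Rightarrow> real \<Rightarrow> real" where
  "pole_free_quotient' A x = (phi' x * psi x - phi x * psi' x) / (psi x)\<^sup>2 - (\<Sum>y\<in>A. residue_weight y / (x - y)\<^sup>2)"

text \<open>
  The bound for \<open>typically_real_remainder\<close> on the circle of radius \<open>r/2\<close>, and its consequence
  for the derivative by Cauchy's estimate on the unit disc around \<open>x\<close>.
\<close>

lemma pole_free_quotient_remainder:
  fixes A :: "real set"
  assumes fin: "finite A" and A: "\<And>x. x \<in> A \<Longrightarrow> x \<noteq> 0 \<and> psi x = 0"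
    and all: "\<And>x. \<bar>x\<bar> < r \<Longrightarrow> psi x = 0 \<Longrightarrow> x \<in> A" and r: "0 < r"
  shows "0 \<le> pole_free_quotient' A 0"
    and "\<And>x. \<bar>x\<bar> \<le> r / 4 \<Longrightarrow> psi x \<noteq> 0 \<Longrightarrow>
           \<bar>pole_free_quotient A x - pole_free_quotient A 0 - x * pole_free_quotient' A 0\<bar> \<le> 12 * pole_free_quotient' A 0 * x\<^sup>2 / r"
    and "\<And>x. \<bar>x\<bar> + 1 \<le> r / 4 \<Longrightarrow> psi x \<noteq> 0 \<Longrightarrow>
           \<bar>pole_free_quotient' A x - pole_free_quotient' A 0\<bar> \<le> 12 * pole_free_quotient' A 0 * (\<bar>x\<bar> + 1)\<^sup>2 / r"
proof -
  define m where "m w = phi w / psi w + (\<Sum>x\<in>A. of_real (residue_weight x) / (w - of_real x))" for w :: complex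
  obtain H where H: "H holomorphic_on ball 0 r" "\<And>w. cmod w < r \<Longrightarrow> psi w \<noteq> 0 \<Longrightarrow> H w = m w"
    using pole_free_part[OF fin A all] unfolding m_def by blast
  have Hx: "H (of_real x) = of_real (pole_free_quotient A x)" if "\<bar>x\<bar> < r" "psi x \<noteq> 0" for x
    using H(2)[of "of_real x"] that
    by (simp add: m_def pole_free_quotient_def phi_of_real psi_of_real)
  have dH: "(H has_field_derivative of_real (pole_free_quotient' A x)) (at (of_real x))"
    if x: "\<bar>x\<bar> < r" "psi x \<noteq> 0" for x
  proof -
    have nz: "psi (of_real x :: complex) \<noteq> 0" using x by (simp add: psi_of_real)
    have nA: "x \<notin> A" using A x by blast
    have "(m has_field_derivative
        (phi' (of_real x) * psi (of_real x) - phi (of_real x) * psi' (of_real x)) / (psi (of_real x) * psi (of_real x))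
        + (\<Sum>y\<in>A. - of_real (residue_weight y) / (of_real x - of_real y)\<^sup>2)) (at (of_real x))"
      unfolding m_def
    proof (intro DERIV_add DERIV_divide DERIV_sum phi_deriv psi_deriv nz)
      fix y assume "y \<in> A"
      then have "of_real x - of_real y \<noteq> (0::complex)" using nA by auto
      then show "((\<lambda>w. of_real (residue_weight y) / (w - of_real y)) has_field_derivative
          - of_real (residue_weight y) / (of_real x - of_real y)\<^sup>2) (at (of_real x))"
        by (auto intro!: derivative_eq_intros simp: power2_eq_square)
    qed
    also have "(phi' (of_real x) * psi (of_real x) - phi (of_real x) * psi' (of_real x)) / (psi (of_real x) * psi (of_real x))
        + (\<Sum>y\<in>A. - of_real (residue_weight y) / (of_real x - of_real y)\<^sup>2) = complex_of_real (pole_free_quotient' A x)"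
      by (simp add: pole_free_quotient'_def phi_of_real psi_of_real phi'_of_real psi'_of_real power2_eq_square sum_negf)
    finally have D: "(m has_field_derivative of_real (pole_free_quotient' A x)) (at (of_real x))" .
    have "isCont (psi :: complex \<Rightarrow> complex) (of_real x)" using psi_deriv by (rule DERIV_isCont)
    then have "\<forall>\<^sub>F w in nhds (of_real x). psi w \<noteq> (0::complex)"
      using nz by (simp add: isCont_def tendsto_imp_eventually_ne continuous_within eventually_nhds_conv_at)
    moreover have "\<forall>\<^sub>F w in nhds (complex_of_real x). w \<in> ball 0 r"
      using x by (intro eventually_nhds_in_open) auto
    ultimately have "\<forall>\<^sub>F w in nhds (of_real x). H w = m w"
      by eventually_elim (simp add: H(2))
    then show ?thesis
      using D DERIV_cong_ev[OF refl _ refl] by blast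
  qed
  have p0: "psi (0::real) \<noteq> 0" using psi_0_neg by simp
  define c where "c = pole_free_quotient' A 0"
  have dH0: "deriv H 0 = of_real c"
    using DERIV_imp_deriv[OF dH[of 0]] r p0 by (simp add: c_def)
  have H0: "H 0 = of_real (pole_free_quotient A 0)" using Hx[of 0] r p0 by simp
  have pos: "0 \<le> Im w * Im (H w)" if "cmod w = r / 2" "Im w \<noteq> 0" for w
  proof -
    have "psi w \<noteq> 0" using psi_zero_real that by blast
    then have "H w = m w" using H(2) that r by simp
    then show ?thesis using quotient_typically_real[OF fin A that(2)] by (simp add: m_def)
  qed
  have R: "0 < r / 2" "r / 2 < r" using r by simp_all
  note T = typically_real_remainder[OF H(1) R _ _ pos]
  have c0: "0 \<le> c" using T(1) by (simp add: H0 dH0)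
  then show "0 \<le> pole_free_quotient' A 0" by (simp add: c_def)
  have bound: "cmod (H w - H 0 - w * of_real c) \<le> 12 * c * (cmod w)\<^sup>2 / r" if "cmod w \<le> r / 4" for w
    using T(2)[of w] that by (simp add: H0 dH0)
  show "\<bar>pole_free_quotient A x - pole_free_quotient A 0 - x * pole_free_quotient' A 0\<bar> \<le> 12 * pole_free_quotient' A 0 * x\<^sup>2 / r"
    if x: "\<bar>x\<bar> \<le> r / 4" "psi x \<noteq> 0" for x
  proof -
    have "H (of_real x) - H 0 - of_real x * of_real c
        = of_real (pole_free_quotient A x - pole_free_quotient A 0 - x * pole_free_quotient' A 0)"
      using Hx[of x] x r by (simp add: H0 c_def)
    then show ?thesis
      using bound[of "of_real x"] x by (simp only: norm_of_real) (simp add: c_def)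
  qed
  show "\<bar>pole_free_quotient' A x - pole_free_quotient' A 0\<bar> \<le> 12 * pole_free_quotient' A 0 * (\<bar>x\<bar> + 1)\<^sup>2 / r"
    if x: "\<bar>x\<bar> + 1 \<le> r / 4" "psi x \<noteq> 0" for x
  proof -
    define q where "q w = H w - H 0 - w * of_real c" for w
    have sub: "cball (complex_of_real x) 1 \<subseteq> ball 0 r"
    proof
      fix w assume "w \<in> cball (complex_of_real x) 1"
      then have "cmod w \<le> \<bar>x\<bar> + 1"
        using norm_triangle_ineq4[of "of_real x" "of_real x - w"] by (simp add: dist_norm)
      then show "w \<in> ball 0 r" using x r by simp
    qed
    have "norm ((deriv ^^ 1) q (of_real x)) \<le> fact 1 * (12 * c * (\<bar>x\<bar> + 1)\<^sup>2 / r) / 1 ^ 1"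
    proof (rule Cauchy_inequality)
      have hq: "q holomorphic_on cball (of_real x) 1"
        unfolding q_def by (intro holomorphic_intros holomorphic_on_subset[OF H(1) sub])
      then show "continuous_on (cball (of_real x) 1) q"
        by (rule holomorphic_on_imp_continuous_on)
      show "q holomorphic_on ball (of_real x) 1"
        using hq by (rule holomorphic_on_subset) auto
      fix w assume w: "norm (complex_of_real x - w) = 1"
      have nw: "cmod w \<le> \<bar>x\<bar> + 1"
        using norm_triangle_ineq4[of "of_real x" "of_real x - w"] w by simp
      then have "norm (q w) \<le> 12 * c * (cmod w)\<^sup>2 / r"
        unfolding q_def using x by (intro bound) simp
      also have "\<dots> \<le> 12 * c * (\<bar>x\<bar> + 1)\<^sup>2 / r"
        using nw c0 r by (intro divide_right_mono mult_left_mono power_mono) auto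
      finally show "norm (q w) \<le> 12 * c * (\<bar>x\<bar> + 1)\<^sup>2 / r" .
    qed simp
    moreover have "deriv q (of_real x) = of_real (pole_free_quotient' A x - c)"
    proof (rule DERIV_imp_deriv)
      have "\<bar>x\<bar> < r" using x r by simp
      from dH[OF this x(2)]
      show "(q has_field_derivative of_real (pole_free_quotient' A x - c)) (at (of_real x))"
        unfolding q_def by (auto intro!: derivative_eq_intros)
    qed
    ultimately have "norm (complex_of_real (pole_free_quotient' A x - c)) \<le> 12 * c * (\<bar>x\<bar> + 1)\<^sup>2 / r" by simp
    then show ?thesis by (simp only: norm_of_real) (simp add: c_def)
  qed
qed

text \<open>
  The derivative at \<open>a\<close> of the Mittag-Leffler expansion of \<open>phi/psi\<close>, whose value there is
  \<open>phi'(a)/psi(a) = 1/(2 a)\<close> as \<open>phi(a) = 0\<close>. After \<open>k\<close> poles have been subtracted, the quotient is linear up to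
  an error that tends to \<open>0\<close> with \<open>1/e k\<close>, so the partial sums converge to \<open>1/(2 a) - B\<close>, where
  \<open>B \<ge> 0\<close> is the limiting slope. Towards \<open>- \<infinity>\<close> the quotient \<open>phi/psi\<close> is eventually positive and the
  terms of the positive poles have a favourable sign, which bounds \<open>y B\<close> independently of
  \<open>y\<close> and forces \<open>B = 0\<close>.
\<close>

lemma mittag_leffler_derivative:
  fixes e :: "nat \<Rightarrow> real" and a :: real
  assumes inj: "inj e" and zero: "\<And>k. psi (e k) = 0"
    and neg: "e 0 < 0" and pos: "\<And>k. 0 < k \<Longrightarrow> 0 < e k"
    and all: "\<And>k x. 0 < k \<Longrightarrow> \<bar>x\<bar> < e k \<Longrightarrow> psi x = 0 \<Longrightarrow> x \<in> e ` {..<k}"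
    and lim: "filterlim e at_top sequentially"
    and a: "a \<noteq> 0" "phi a = 0"
  shows "(\<lambda>k. residue_weight (e k) / (a - e k)\<^sup>2) sums (1 / (2 * a))"
proof -
  define \<rho> where "\<rho> k = residue_weight (e k)" for k
  have e0: "e k \<noteq> 0" for k using neg pos[of k] by (cases "k = 0") auto
  have \<rho>: "0 < \<rho> k" for k unfolding \<rho>_def by (rule residue_weight_pos[OF e0 zero])
  have A: "x \<noteq> 0 \<and> psi x = 0" if "x \<in> e ` {..<k}" for x k using that e0 zero by auto
  have sum_e: "(\<Sum>y\<in>e ` {..<k}. f y) = (\<Sum>j<k. f (e j))" for f :: "real \<Rightarrow> real" and k
    using inj by (simp add: sum.reindex inj_on_def inj_def)
  have p0: "psi (0::real) \<noteq> 0" using psi_0_neg by simp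
  define c where "c k = pole_free_quotient' (e ` {..<k}) 0" for k
  define d where "d = pole_free_quotient' {} 0"
  have c_eq: "c k = d - (\<Sum>j<k. \<rho> j / (e j)\<^sup>2)" for k
    unfolding c_def d_def pole_free_quotient'_def sum_e \<rho>_def by simp
  have c_nonneg: "0 \<le> c k" if "0 < k" for k
    unfolding c_def using all[OF that] pos[OF that] A by (intro pole_free_quotient_remainder(1)) auto
  have c_le: "c k \<le> d" for k
    unfolding c_eq using \<rho> by (simp add: sum_nonneg less_imp_le)
  have "summable (\<lambda>j. \<rho> j / (e j)\<^sup>2)"
  proof (rule summableI_nonneg_bounded)
    show "(\<Sum>j<k. \<rho> j / (e j)\<^sup>2) \<le> d" for k
    proof -
      have "(\<Sum>j<k. \<rho> j / (e j)\<^sup>2) \<le> (\<Sum>j<Suc k. \<rho> j / (e j)\<^sup>2)"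
        using \<rho>[of k] by simp
      then show ?thesis using c_nonneg[of "Suc k"] unfolding c_eq by linarith
    qed
  qed (use \<rho> in \<open>simp add: less_imp_le\<close>)
  then have "c \<longlonglongrightarrow> d - (\<Sum>j. \<rho> j / (e j)\<^sup>2)"
    unfolding c_eq by (intro tendsto_intros summable_LIMSEQ)
  then obtain B where B: "c \<longlonglongrightarrow> B" by blast
  have einv: "(\<lambda>k. C / e k) \<longlonglongrightarrow> 0" for C
    by (rule tendsto_divide_0[OF tendsto_const filterlim_at_top_imp_at_infinity[OF lim]])
  have large: "\<forall>\<^sub>F k in sequentially. 0 < k \<and> M \<le> e k / 4" for M
  proof -
    have "\<forall>\<^sub>F k in sequentially. 4 * M \<le> e k"
      using lim by (auto simp: filterlim_at_top)
    with eventually_gt_at_top[of "0::nat"] show ?thesis by eventually_elim auto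
  qed
  have pa: "psi a \<noteq> 0" using no_common_zero a by blast
  define S where "S k = (\<Sum>j<k. \<rho> j / (a - e j)\<^sup>2)" for k
  have "pole_free_quotient' (e ` {..<k}) a = 1 / (2 * a) - S k" for k
  proof -
    have "2 * a * phi' a = psi a" using phi_system[of a] a by simp
    then have "phi' a = psi a / (2 * a)" using a(1) by (simp add: eq_divide_eq mult.commute)
    then have "(phi' a * psi a - phi a * psi' a) / (psi a)\<^sup>2 = 1 / (2 * a)"
      using pa by (simp only: a(2)) (simp add: power2_eq_square)
    then show ?thesis unfolding pole_free_quotient'_def S_def sum_e \<rho>_def by simp
  qed
  note c'a = this
  have "(\<lambda>k. 1 / (2 * a) - S k - c k) \<longlonglongrightarrow> 0"
  proof (rule Lim_null_comparison)
    show "\<forall>\<^sub>F k in sequentially. norm (1 / (2 * a) - S k - c k) \<le> 12 * d * (\<bar>a\<bar> + 1)\<^sup>2 / e k"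
      using large[of "\<bar>a\<bar> + 1"]
    proof eventually_elim
      case (elim k)
      have "\<bar>pole_free_quotient' (e ` {..<k}) a - pole_free_quotient' (e ` {..<k}) 0\<bar>
          \<le> 12 * pole_free_quotient' (e ` {..<k}) 0 * (\<bar>a\<bar> + 1)\<^sup>2 / e k"
        using elim all[of k] pos[of k] A pa by (intro pole_free_quotient_remainder(3)) auto
      then have "norm (1 / (2 * a) - S k - c k) \<le> 12 * c k * (\<bar>a\<bar> + 1)\<^sup>2 / e k"
        by (simp add: c'a c_def)
      also have "\<dots> \<le> 12 * d * (\<bar>a\<bar> + 1)\<^sup>2 / e k"
        using c_le pos[of k] elim by (intro divide_right_mono mult_right_mono mult_left_mono) auto
      finally show ?case .
    qed
  qed (rule einv)
  from tendsto_add[OF this B] have SB: "(\<lambda>k. 1 / (2 * a) - S k) \<longlonglongrightarrow> B" by simp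
  have B0: "0 \<le> B"
    using B by (rule LIMSEQ_le_const) (use c_nonneg in \<open>auto intro!: exI[of _ 1]\<close>)
  define b where "b = - e 0"
  have b: "b > 0" using neg by (simp add: b_def)
  have yB: "y * B \<le> 2 * \<rho> 0 / b" if y: "y \<ge> 2 * b" for y
  proof -
    have py: "psi (- y) > 0"
    proof -
      obtain b' where b': "b' > 0" "psi (- b' :: real) = 0"
          "\<And>x. x \<le> 0 \<Longrightarrow> psi x = 0 \<Longrightarrow> x = - b'" "\<And>x. x < - b' \<Longrightarrow> psi x > 0"
        using negative_zero by blast
      have "b' = b" using b'(3)[of "e 0"] zero neg by (simp add: b_def)
      then show ?thesis using b'(4)[of "- y"] y b by simp
    qed
    have "\<forall>\<^sub>F k in sequentially. y * c k - 2 * \<rho> 0 / b \<le> 12 * d * y\<^sup>2 / e k"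
      using large[of y]
    proof eventually_elim
      case (elim k)
      let ?A = "e ` {..<k}"
      have "\<bar>pole_free_quotient ?A (- y) - pole_free_quotient ?A 0 - (- y) * pole_free_quotient' ?A 0\<bar>
          \<le> 12 * pole_free_quotient' ?A 0 * (- y)\<^sup>2 / e k"
        using elim all[of k] pos[of k] A py y b by (intro pole_free_quotient_remainder(2)) auto
      then have "pole_free_quotient ?A (- y) - pole_free_quotient ?A 0 + y * c k \<le> 12 * c k * y\<^sup>2 / e k"
        by (simp add: c_def)
      also have "\<dots> \<le> 12 * d * y\<^sup>2 / e k"
        using c_le pos[of k] elim by (intro divide_right_mono mult_right_mono mult_left_mono) auto
      finally have 1: "pole_free_quotient ?A (- y) - pole_free_quotient ?A 0 + y * c k \<le> 12 * d * y\<^sup>2 / e k" .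
      have "pole_free_quotient ?A (- y) - pole_free_quotient ?A 0
          = phi (- y) / psi (- y) - phi 0 / psi 0 + (\<Sum>j<k. \<rho> j * (1 / (- y - e j) + 1 / e j))"
        unfolding pole_free_quotient_def sum_e \<rho>_def
        by (simp add: sum.distrib sum_subtractf sum_negf distrib_left)
      moreover have "phi (- y) / psi (- y) \<ge> 0"
        using phi_pos[of "- y"] py y b by simp
      moreover have "phi 0 / psi 0 \<le> (0::real)"
        using phi_pos[of 0] psi_0_neg by (simp add: divide_nonneg_neg)
      moreover have "(\<Sum>j<k. \<rho> j * (1 / (- y - e j) + 1 / e j)) \<ge> - (2 * \<rho> 0 / b)"
      proof -
        have "(\<Sum>j<k. if j = 0 then - (2 * \<rho> 0 / b) else 0) \<le> (\<Sum>j<k. \<rho> j * (1 / (- y - e j) + 1 / e j))"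
        proof (rule sum_mono)
          fix j
          show "(if j = 0 then - (2 * \<rho> 0 / b) else 0) \<le> \<rho> j * (1 / (- y - e j) + 1 / e j)"
          proof (cases "j = 0")
            case True
            have "1 / (y - b) \<le> 1 / b" using y b by (intro divide_left_mono) auto
            moreover have "1 / (- y - e 0) = - (1 / (y - b))" "1 / e 0 = - (1 / b)"
              using minus_divide_right[of 1 "y - b"] minus_divide_right[of 1 b] by (simp_all add: b_def)
            ultimately have "- (2 / b) \<le> 1 / (- y - e 0) + 1 / e 0" by simp
            from mult_left_mono[OF this less_imp_le[OF \<rho>[of 0]]] True show ?thesis by (simp add: mult_ac)
          next
            case False
            then have ej: "e j > 0" using pos by simp
            have "1 / (- y - e j) = - (1 / (y + e j))"
              using minus_divide_right[of 1 "y + e j"] by simp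
            moreover have "1 / (y + e j) \<le> 1 / e j"
              using ej y b by (intro divide_left_mono) auto
            ultimately show ?thesis using \<rho>[of j] False by simp
          qed
        qed
        moreover have "(\<Sum>j<k. if j = 0 then - (2 * \<rho> 0 / b) else 0) = - (2 * \<rho> 0 / b)"
          using elim by (simp add: sum.delta)
        ultimately show ?thesis by simp
      qed
      ultimately show ?case using 1 by linarith
    qed
    then have "y * B - 2 * \<rho> 0 / b \<le> 0"
      using tendsto_le[OF _ einv[of "12 * d * y\<^sup>2"] tendsto_diff[OF tendsto_mult[OF tendsto_const B] tendsto_const]]
      by simp
    then show ?thesis by simp
  qed
  have "B = 0"
  proof (rule ccontr)
    assume "B \<noteq> 0"
    then have "B > 0" using B0 by simp
    define y where "y = max (2 * b) (2 * \<rho> 0 / b / B + 1)"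
    have "2 * \<rho> 0 / b < (2 * \<rho> 0 / b / B + 1) * B" using \<open>B > 0\<close> by (simp add: distrib_right)
    also have "\<dots> \<le> y * B" using \<open>B > 0\<close> by (intro mult_right_mono) (auto simp: y_def)
    finally show False using yB[of y] by (simp add: y_def)
  qed
  with tendsto_diff[OF tendsto_const[of "1 / (2 * a)"] SB] have "S \<longlonglongrightarrow> 1 / (2 * a)" by simp
  then show ?thesis unfolding sums_def S_def[abs_def] \<rho>_def .
qed

end

section \<open>Enumeration of zeros and oscillation\<close>

text \<open>
  A nonempty set of reals may lack a least element, in which case the recursion breaks down; local
  finiteness of the zeros excludes this.
\<close>

lemma pos_zero_Suc:
  assumes fin: "\<And>r. finite {x. 0 < x \<and> x \<le> r \<and> f x = 0}"
    and unb: "\<And>r. \<exists>x>r. f x = (0::real)"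
  shows "pos_zero f n \<ge> 0"
    and "pos_zero f n < pos_zero f (Suc n)"
    and "f (pos_zero f (Suc n)) = 0"
    and "\<And>y. pos_zero f n < y \<Longrightarrow> f y = 0 \<Longrightarrow> pos_zero f (Suc n) \<le> y"
proof -
  have least: "r < (LEAST x. r < x \<and> f x = 0) \<and> f (LEAST x. r < x \<and> f x = 0) = 0
      \<and> (\<forall>y. r < y \<longrightarrow> f y = 0 \<longrightarrow> (LEAST x. r < x \<and> f x = 0) \<le> y)" if "r \<ge> 0" for r
  proof -
    obtain x where x: "x > r" "f x = 0" using unb by blast
    define Z where "Z = {y. r < y \<and> y \<le> x \<and> f y = 0}"
    have "finite Z"
      by (rule finite_subset[OF _ fin[of x]]) (use that in \<open>auto simp: Z_def\<close>)
    moreover have "x \<in> Z" using x by (simp add: Z_def)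
    ultimately have m: "Min Z \<in> Z" "\<And>y. y \<in> Z \<Longrightarrow> Min Z \<le> y"
      by (auto intro: Min_in)
    have min: "Min Z \<le> y" if "r < y" "f y = 0" for y
      using m(2)[of y] m(2)[OF \<open>x \<in> Z\<close>] that by (cases "y \<le> x") (auto simp: Z_def)
    have "(LEAST x. r < x \<and> f x = 0) = Min Z"
      by (rule Least_equality) (use m(1) min in \<open>auto simp: Z_def\<close>)
    then show ?thesis using m(1) min by (auto simp: Z_def)
  qed
  show nn: "pos_zero f n \<ge> 0"
  proof (induction n)
    case (Suc n)
    then show ?case using least[of "pos_zero f n"] by simp
  qed simp
  show "pos_zero f n < pos_zero f (Suc n)" "f (pos_zero f (Suc n)) = 0"
    "\<And>y. pos_zero f n < y \<Longrightarrow> f y = 0 \<Longrightarrow> pos_zero f (Suc n) \<le> y"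
    using least[OF nn] by simp_all
qed

lemma pos_zero_enumerates:
  assumes fin: "\<And>r. finite {x. 0 < x \<and> x \<le> r \<and> f x = 0}"
    and unb: "\<And>r. \<exists>x>r. f x = (0::real)"
  shows "strict_mono (pos_zero f)"
    and "0 < y \<Longrightarrow> f y = 0 \<Longrightarrow> \<exists>k. y = pos_zero f (Suc k)"
    and "filterlim (pos_zero f) at_top sequentially"
proof -
  note step = pos_zero_Suc[OF fin unb]
  show mono: "strict_mono (pos_zero f)"
    unfolding strict_mono_Suc_iff using step(2) by blast
  show onto: "\<exists>k. y = pos_zero f (Suc k)" if y: "0 < y" "f y = 0" for y
  proof (rule ccontr)
    assume none: "\<nexists>k. y = pos_zero f (Suc k)"
    have lt: "pos_zero f n < y" for n
    proof (induction n)
      case (Suc n)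
      from step(4)[OF this y(2)] none show ?case by (metis order_le_less)
    qed (simp add: y)
    have "range (\<lambda>n. pos_zero f (Suc n)) \<subseteq> {x. 0 < x \<and> x \<le> y \<and> f x = 0}"
    proof
      fix x assume "x \<in> range (\<lambda>n. pos_zero f (Suc n))"
      then obtain n where x: "x = pos_zero f (Suc n)" by blast
      show "x \<in> {x. 0 < x \<and> x \<le> y \<and> f x = 0}"
        using step(1)[of n] step(2,3)[of n] lt[of "Suc n"] unfolding x by auto
    qed
    then have "finite (range (\<lambda>n. pos_zero f (Suc n)))" using fin finite_subset by blast
    moreover have "inj (\<lambda>n. pos_zero f (Suc n))"
      by (intro injI) (metis strict_mono_eq[OF mono] Suc_inject)
    ultimately show False using finite_imageD by blast
  qed
  show "filterlim (pos_zero f) at_top sequentially"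
    unfolding filterlim_at_top
  proof
    fix M
    obtain y where y: "y > max 0 M" "f y = 0" using unb by blast
    then obtain k where "y = pos_zero f (Suc k)" using onto[of y] by auto
    then have "M \<le> pos_zero f n" if "n \<ge> Suc k" for n
      using strict_mono_leD[OF mono that] y by simp
    then show "\<forall>\<^sub>F n in sequentially. M \<le> pos_zero f n"
      unfolding eventually_sequentially by blast
  qed
qed

text \<open>
  Here \<open>F = x y'\<close> and \<open>x F' = (\<nu>\<^sup>2 - x\<^sup>2) y\<close>: in the variable \<open>t = log x\<close> a positive solution is concave
  for large \<open>t\<close>. A concave function that stays positive on a half line cannot decrease, so
  \<open>y\<close> is bounded below; but then \<open>F' \<le> - c\<close>, and \<open>F\<close> becomes negative after all.
\<close>

lemma no_eventually_positive_solution: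
  fixes y F :: "real \<Rightarrow> real"
  assumes nu: "\<nu>\<^sup>2 < 1" and X: "2 \<le> X"
    and dy: "\<And>x. 0 < x \<Longrightarrow> (y has_real_derivative F x / x) (at x)"
    and dF: "\<And>x. 0 < x \<Longrightarrow> (F has_real_derivative (\<nu>\<^sup>2 - x\<^sup>2) * y x / x) (at x)"
    and pos: "\<And>x. X \<le> x \<Longrightarrow> 0 < y x"
  shows False
proof -
  have sq: "\<nu>\<^sup>2 - x\<^sup>2 \<le> - x" if "x \<ge> 2" for x
  proof -
    have "2 * x \<le> x\<^sup>2" using that by (simp add: power2_eq_square)
    then show ?thesis using that nu by linarith
  qed
  have F_anti: "F v \<le> F u" if "X \<le> u" "u \<le> v" for u v
  proof (rule DERIV_nonpos_imp_nonincreasing[OF that(2)])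
    fix x assume "u \<le> x" "x \<le> v"
    then have x: "X \<le> x" "x \<ge> 2" using that X by simp_all
    have "(\<nu>\<^sup>2 - x\<^sup>2) * y x / x \<le> 0"
      using sq[OF x(2)] pos[OF x(1)] x(2) by (intro divide_nonpos_pos mult_nonpos_nonneg) auto
    then show "\<exists>d. (F has_real_derivative d) (at x) \<and> d \<le> 0" using dF[of x] x(2) by auto
  qed
  have F_nonneg: "0 \<le> F u" if u: "X \<le> u" for u
  proof (rule ccontr)
    assume "\<not> 0 \<le> F u"
    define \<delta> where "\<delta> = - F u"
    have \<delta>: "\<delta> > 0" using \<open>\<not> 0 \<le> F u\<close> by (simp add: \<delta>_def)
    have u0: "u > 0" using u X by simp
    define v where "v = u * exp (y u / \<delta>)"
    have "y u / \<delta> \<ge> 0" using pos[OF u] \<delta> by simp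
    then have uv: "u \<le> v" using u0 by (simp add: v_def)
    have "y v + \<delta> * ln v \<le> y u + \<delta> * ln u"
    proof (rule DERIV_nonpos_imp_nonincreasing[OF uv])
      fix x assume x: "u \<le> x" "x \<le> v"
      then have "x > 0" using u0 by simp
      have "((\<lambda>x. y x + \<delta> * ln x) has_real_derivative F x / x + \<delta> * (1 / x)) (at x)"
        using \<open>x > 0\<close> by (auto intro!: derivative_eq_intros dy)
      moreover have "F x / x + \<delta> * (1 / x) \<le> 0"
        using F_anti[OF u x(1)] \<open>x > 0\<close> by (simp add: \<delta>_def divide_right_mono)
      ultimately show "\<exists>d. ((\<lambda>x. y x + \<delta> * ln x) has_real_derivative d) (at x) \<and> d \<le> 0" by blast
    qed
    moreover have "\<delta> * ln v = \<delta> * ln u + y u"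
      using u0 \<delta> by (simp add: v_def ln_mult distrib_left)
    ultimately have "y v \<le> 0" by simp
    then show False using pos[of v] u uv by simp
  qed
  define c where "c = y X"
  have c: "c > 0" using pos by (simp add: c_def)
  have y_ge: "c \<le> y u" if "X \<le> u" for u
    unfolding c_def
  proof (rule DERIV_nonneg_imp_nondecreasing[OF that])
    fix x assume "X \<le> x" "x \<le> u"
    then show "\<exists>d. (y has_real_derivative d) (at x) \<and> 0 \<le> d"
      using dy[of x] F_nonneg[of x] X by (intro exI[of _ "F x / x"]) auto
  qed
  define v where "v = X + F X / c + 1"
  have Xv: "X \<le> v" using F_nonneg[of X] c by (simp add: v_def)
  have "F v + c * v \<le> F X + c * X"
  proof (rule DERIV_nonpos_imp_nonincreasing[OF Xv])
    fix x assume x: "X \<le> x" "x \<le> v"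
    then have x2: "x \<ge> 2" using X by simp
    have "((\<lambda>x. F x + c * x) has_real_derivative (\<nu>\<^sup>2 - x\<^sup>2) * y x / x + c) (at x)"
      using x2 by (auto intro!: derivative_eq_intros dF)
    moreover have "(\<nu>\<^sup>2 - x\<^sup>2) * y x / x + c \<le> 0"
    proof -
      have "(\<nu>\<^sup>2 - x\<^sup>2) * y x \<le> (- x) * y x"
        using sq[OF x2] pos[OF x(1)] by (intro mult_right_mono) auto
      also have "\<dots> \<le> - x * c"
        using y_ge[OF x(1)] x2 by simp
      finally have "(\<nu>\<^sup>2 - x\<^sup>2) * y x / x \<le> - x * c / x"
        using x2 by (intro divide_right_mono) auto
      then show ?thesis using x2 by simp
    qed
    ultimately show "\<exists>d. ((\<lambda>x. F x + c * x) has_real_derivative d) (at x) \<and> d \<le> 0" by blast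
  qed
  then have "F v \<le> - c" using c by (simp add: v_def distrib_left)
  then show False using F_nonneg[OF Xv] c by simp
qed

lemma solution_oscillates:
  fixes y F :: "real \<Rightarrow> real"
  assumes nu: "\<nu>\<^sup>2 < 1"
    and dy: "\<And>x. 0 < x \<Longrightarrow> (y has_real_derivative F x / x) (at x)"
    and dF: "\<And>x. 0 < x \<Longrightarrow> (F has_real_derivative (\<nu>\<^sup>2 - x\<^sup>2) * y x / x) (at x)"
  shows "\<exists>x>r. y x = 0"
proof (rule ccontr)
  assume none: "\<not> (\<exists>x>r. y x = 0)"
  define X where "X = max 2 (r + 1)"
  have X: "2 \<le> X" "r < X" by (simp_all add: X_def)
  have cont: "continuous_on {X..x} y" for x
    using X by (intro continuous_at_imp_continuous_on ballI DERIV_isCont[OF dy]) auto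
  show False
  proof (cases "y X > 0")
    case True
    have "0 < y x" if "X \<le> x" for x
    proof (rule ccontr)
      assume "\<not> 0 < y x"
      then have "\<exists>z\<ge>X. z \<le> x \<and> y z = 0"
        using True that by (intro IVT2' cont) auto
      then show False using none X by force
    qed
    then show False using no_eventually_positive_solution[OF nu X(1) dy dF] by blast
  next
    case False
    have "0 < - y x" if "X \<le> x" for x
    proof (rule ccontr)
      assume "\<not> 0 < - y x"
      then have "\<exists>z\<ge>X. z \<le> x \<and> y z = 0"
        using False that by (intro IVT' cont) auto
      then show False using none X by force
    qed
    then show False
      using no_eventually_positive_solution[OF nu X(1), of "\<lambda>x. - y x" "\<lambda>x. - F x"]
        DERIV_minus[OF dy] DERIV_minus[OF dF] by simp
  qed
qed

section \<open>Translation to Bessel functions\<close>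

context bessel_order begin

lemma bessel_series_eq:
  assumes x: "0 < x" and s: "\<bar>s\<bar> = 1"
  shows "(\<Sum>m. s ^ m / fact m * rGamma (\<nu> + real m + 1) * (x / 2) powr (2 * real m + \<nu>))
     = (x / 2) powr \<nu> * phi (- s * x\<^sup>2)"
proof -
  have "(\<lambda>m. (x / 2) powr \<nu> * (coef m * (- s * x\<^sup>2) ^ m)) sums ((x / 2) powr \<nu> * phi (- s * x\<^sup>2))"
    unfolding phi_def using power_series_sums[OF everywhere_convergent_coef, of "- s * x\<^sup>2"]
    by (intro sums_mult) simp
  moreover have "(x / 2) powr \<nu> * (coef m * (- s * x\<^sup>2) ^ m)
      = s ^ m / fact m * rGamma (\<nu> + real m + 1) * (x / 2) powr (2 * real m + \<nu>)" for m
  proof -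
    have "(x / 2) powr (2 * real m + \<nu>) = ((x / 2)\<^sup>2) ^ m * (x / 2) powr \<nu>"
      using x powr_realpow[of "x / 2" "2 * m"] by (simp add: powr_add power_mult)
    moreover have "(- 1 / 4) ^ m * (- s * x\<^sup>2) ^ m = s ^ m * ((x / 2)\<^sup>2) ^ m"
      by (simp add: power_mult_distrib[symmetric] power_divide)
    ultimately show ?thesis
      by (simp add: coef_def mult_ac)
  qed
  ultimately show ?thesis by (simp add: sums_iff)
qed

lemma bessel_J_eq: "0 < x \<Longrightarrow> bessel_J \<nu> x = (x / 2) powr \<nu> * phi (x\<^sup>2)"
  unfolding bessel_J_def using bessel_series_eq[of x "- 1"] by simp

lemma bessel_I_eq: "0 < x \<Longrightarrow> bessel_I \<nu> x = (x / 2) powr \<nu> * phi (- x\<^sup>2)"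
  unfolding bessel_I_def using bessel_series_eq[of x 1] by simp

lemma phi_scaled_deriv:
  assumes x: "0 < x"
  shows "((\<lambda>x. (x / 2) powr \<nu> * phi (s * x\<^sup>2)) has_real_derivative (x / 2) powr \<nu> * psi (s * x\<^sup>2) / x) (at x)"
proof -
  have p: "((\<lambda>x. (x / 2) powr \<nu>) has_real_derivative \<nu> * (x / 2) powr \<nu> / x) (at x)"
    using x by (auto intro!: derivative_eq_intros simp: powr_diff)
  have q: "((\<lambda>x. phi (s * x\<^sup>2)) has_real_derivative phi' (s * x\<^sup>2) * (s * (2 * x))) (at x)"
    by (rule DERIV_chain2[OF phi_deriv]) (auto intro!: derivative_eq_intros)
  have "psi (s * x\<^sup>2) = \<nu> * phi (s * x\<^sup>2) + 2 * (s * x\<^sup>2) * phi' (s * x\<^sup>2)"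
    using phi_system[of "s * x\<^sup>2"] by simp
  then have "\<nu> * (x / 2) powr \<nu> / x * phi (s * x\<^sup>2) + phi' (s * x\<^sup>2) * (s * (2 * x)) * (x / 2) powr \<nu>
      = (x / 2) powr \<nu> * psi (s * x\<^sup>2) / x"
    using x by (simp add: field_simps power2_eq_square)
  with DERIV_mult[OF p q] show ?thesis by simp
qed

lemma psi_scaled_deriv:
  assumes x: "0 < x"
  shows "((\<lambda>x. (x / 2) powr \<nu> * psi (x\<^sup>2)) has_real_derivative
            (\<nu>\<^sup>2 - x\<^sup>2) * ((x / 2) powr \<nu> * phi (x\<^sup>2)) / x) (at x)"
proof -
  have p: "((\<lambda>x. (x / 2) powr \<nu>) has_real_derivative \<nu> * (x / 2) powr \<nu> / x) (at x)"
    using x by (auto intro!: derivative_eq_intros simp: powr_diff)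
  have q: "((\<lambda>x. psi (x\<^sup>2)) has_real_derivative psi' (x\<^sup>2) * (2 * x)) (at x)"
    by (rule DERIV_chain2[OF psi_deriv]) (auto intro!: derivative_eq_intros)
  have sys: "(\<nu>\<^sup>2 - x\<^sup>2) * phi (x\<^sup>2) = \<nu> * psi (x\<^sup>2) + 2 * x\<^sup>2 * psi' (x\<^sup>2)"
    using psi_system[of "x\<^sup>2"] by simp
  have "(\<nu>\<^sup>2 - x\<^sup>2) * ((x / 2) powr \<nu> * phi (x\<^sup>2)) / x
     = (x / 2) powr \<nu> * ((\<nu>\<^sup>2 - x\<^sup>2) * phi (x\<^sup>2)) / x"
    by (simp only: mult_ac)
  also have "\<dots> = (x / 2) powr \<nu> * (\<nu> * psi (x\<^sup>2) + 2 * x\<^sup>2 * psi' (x\<^sup>2)) / x"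
    by (simp only: sys)
  also have "\<dots> = \<nu> * (x / 2) powr \<nu> / x * psi (x\<^sup>2) + psi' (x\<^sup>2) * (2 * x) * (x / 2) powr \<nu>"
    using x by (simp add: field_simps power2_eq_square)
  finally show ?thesis using DERIV_mult[OF p q] by simp
qed

lemma deriv_bessel_J:
  assumes x: "0 < x" shows "deriv (bessel_J \<nu>) x = (x / 2) powr \<nu> * psi (x\<^sup>2) / x"
proof (rule DERIV_imp_deriv)
  show "(bessel_J \<nu> has_real_derivative (x / 2) powr \<nu> * psi (x\<^sup>2) / x) (at x)"
  proof (rule has_field_derivative_transform_within_open)
    show "((\<lambda>x. (x / 2) powr \<nu> * phi (x\<^sup>2)) has_real_derivative (x / 2) powr \<nu> * psi (x\<^sup>2) / x) (at x)"
      using phi_scaled_deriv[OF x, of "1"] by simp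
    show "x \<in> {0<..}" using x by simp
  qed (simp_all add: bessel_J_eq)
qed

lemma deriv_bessel_I:
  assumes x: "0 < x" shows "deriv (bessel_I \<nu>) x = (x / 2) powr \<nu> * psi (- x\<^sup>2) / x"
proof (rule DERIV_imp_deriv)
  show "(bessel_I \<nu> has_real_derivative (x / 2) powr \<nu> * psi (- x\<^sup>2) / x) (at x)"
  proof (rule has_field_derivative_transform_within_open)
    show "((\<lambda>x. (x / 2) powr \<nu> * phi (- x\<^sup>2)) has_real_derivative (x / 2) powr \<nu> * psi (- x\<^sup>2) / x) (at x)"
      using phi_scaled_deriv[OF x, of "- 1"] by simp
    show "x \<in> {0<..}" using x by simp
  qed (simp_all add: bessel_I_eq)
qed

lemma bessel_J_zero_iff: "0 < x \<Longrightarrow> bessel_J \<nu> x = 0 \<longleftrightarrow> phi (x\<^sup>2) = 0"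
  by (simp add: bessel_J_eq)
lemma deriv_bessel_J_zero_iff: "0 < x \<Longrightarrow> deriv (bessel_J \<nu>) x = 0 \<longleftrightarrow> psi (x\<^sup>2) = 0"
  by (simp add: deriv_bessel_J)
lemma deriv_bessel_I_zero_iff: "0 < x \<Longrightarrow> deriv (bessel_I \<nu>) x = 0 \<longleftrightarrow> psi (- x\<^sup>2) = 0"
  by (simp add: deriv_bessel_I)

lemma phi_zeros_unbounded: "\<exists>x>r. phi (x\<^sup>2) = (0::real)"
proof -
  have nu: "\<nu>\<^sup>2 < 1" using order_gt order_neg by (simp add: power2_less_1_iff abs_less_iff)
  have "\<exists>x>max 0 r. (x / 2) powr \<nu> * phi (x\<^sup>2) = (0::real)"
    by (rule solution_oscillates[OF nu, where F = "\<lambda>x. (x / 2) powr \<nu> * psi (x\<^sup>2)"])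
       (use phi_scaled_deriv[of _ 1] psi_scaled_deriv in simp_all)
  then show ?thesis by auto
qed

text \<open>
  Rolle's theorem between two zeros of \<open>J\<^sub>\<nu>\<close>.
\<close>

lemma psi_zeros_unbounded: "\<exists>x>r. psi (x\<^sup>2) = (0::real)"
proof -
  let ?y = "\<lambda>x::real. (x / 2) powr \<nu> * phi (x\<^sup>2)"
  obtain u :: real where u: "max 0 r < u" "phi (u\<^sup>2) = 0" using phi_zeros_unbounded by blast
  obtain v :: real where v: "u < v" "phi (v\<^sup>2) = 0" using phi_zeros_unbounded by blast
  have d: "(?y has_real_derivative (x / 2) powr \<nu> * psi (x\<^sup>2) / x) (at x)" if "0 < x" for x
    using phi_scaled_deriv[OF that, of 1] by simp
  have "\<exists>l z. u < z \<and> z < v \<and> (?y has_real_derivative l) (at z) \<and> ?y v - ?y u = (v - u) * l"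
  proof (rule MVT[OF v(1)])
    show "continuous_on {u..v} ?y"
      using u by (intro continuous_at_imp_continuous_on ballI DERIV_isCont[OF d]) auto
    show "?y differentiable (at x)" if "u < x" for x
      using d[of x] that u unfolding real_differentiable_def by auto
  qed
  then obtain l z where z: "u < z" "z < v" "(?y has_real_derivative l) (at z)" "?y v - ?y u = (v - u) * l"
    by blast
  have "l = 0" using z u v by simp
  moreover have "0 < z" using z u by simp
  ultimately have "psi (z\<^sup>2) = 0" using DERIV_unique[OF z(3) d[OF \<open>0 < z\<close>]] by simp
  then show ?thesis using z u by (intro exI[of _ z]) auto
qed

lemma finite_J_deriv_zeros: "finite {x. 0 < x \<and> x \<le> r \<and> deriv (bessel_J \<nu>) x = 0}"
proof (rule finite_subset)
  show "{x. 0 < x \<and> x \<le> r \<and> deriv (bessel_J \<nu>) x = 0} \<subseteq> sqrt ` {x. \<bar>x\<bar> \<le> r\<^sup>2 \<and> psi x = 0}"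
  proof
    fix x assume "x \<in> {x. 0 < x \<and> x \<le> r \<and> deriv (bessel_J \<nu>) x = 0}"
    then have "0 < x" "x\<^sup>2 \<le> r\<^sup>2" "psi (x\<^sup>2) = 0"
      by (auto simp: deriv_bessel_J_zero_iff intro: power_mono)
    then show "x \<in> sqrt ` {x. \<bar>x\<bar> \<le> r\<^sup>2 \<and> psi x = 0}"
      by (intro image_eqI[of _ _ "x\<^sup>2"]) auto
  qed
qed (simp add: finite_psi_zeros)

lemma finite_J_zeros: "finite {x. 0 < x \<and> x \<le> r \<and> bessel_J \<nu> x = 0}"
proof -
  have "\<not> (phi :: complex \<Rightarrow> complex) constant_on UNIV"
  proof
    assume "(phi :: complex \<Rightarrow> complex) constant_on UNIV"
    then obtain c where c: "\<And>z. phi z = (c::complex)" by (auto simp: constant_on_def)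
    obtain x where "phi (x\<^sup>2 :: real) = 0" using phi_zeros_unbounded by blast
    then have "c = 0" using c phi_of_real[of "x\<^sup>2", where 'a = complex] by (simp only: of_real_0)
    then have "phi (of_real 0) = (of_real 0 :: complex)" using c by simp
    then have "phi 0 = (0::real)" by (simp only: phi_of_real of_real_eq_iff)
    then show False using phi_pos[of 0] by simp
  qed
  then have "finite {z \<in> cball 0 (r\<^sup>2). phi z = (0::complex)}"
    by (intro holomorphic_compact_finite_zeros[OF holomorphic_phi]) auto
  moreover have "(\<lambda>x. complex_of_real (x\<^sup>2)) ` {x. 0 < x \<and> x \<le> r \<and> bessel_J \<nu> x = 0}
      \<subseteq> {z \<in> cball 0 (r\<^sup>2). phi z = 0}"
  proof (rule image_subsetI)
    fix x assume x: "x \<in> {x. 0 < x \<and> x \<le> r \<and> bessel_J \<nu> x = 0}"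
    then have "x\<^sup>2 \<le> r\<^sup>2" "phi (x\<^sup>2) = 0" by (auto simp: bessel_J_zero_iff intro: power_mono)
    then show "complex_of_real (x\<^sup>2) \<in> {z \<in> cball 0 (r\<^sup>2). phi z = 0}"
      by (simp add: phi_of_real del: of_real_power)
  qed
  moreover have "inj_on (\<lambda>x. complex_of_real (x\<^sup>2)) {x. 0 < x \<and> x \<le> r \<and> bessel_J \<nu> x = 0}"
    by (rule inj_onI) (auto simp del: of_real_power simp: power2_eq_iff)
  ultimately show ?thesis using inj_on_finite by blast
qed

lemma J_zeros_unbounded: "\<exists>x>r. bessel_J \<nu> x = 0"
proof -
  obtain x :: real where x: "max 0 r < x" "phi (x\<^sup>2) = 0" using phi_zeros_unbounded by blast
  then have "0 < x" "r < x" by simp_all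
  then show ?thesis using bessel_J_zero_iff[of x] x(2) by blast
qed

lemma J_deriv_zeros_unbounded: "\<exists>x>r. deriv (bessel_J \<nu>) x = 0"
proof -
  obtain x :: real where x: "max 0 r < x" "psi (x\<^sup>2) = 0" using psi_zeros_unbounded by blast
  then have "0 < x" "r < x" by simp_all
  then show ?thesis using deriv_bessel_J_zero_iff[of x] x(2) by blast
qed

lemma I_deriv_zero:
  shows "0 < bessel_I_deriv_zero \<nu>" and "psi (- (bessel_I_deriv_zero \<nu>)\<^sup>2) = 0"
proof -
  obtain b where b: "b > 0" "psi (- b :: real) = 0" "\<And>x. x \<le> 0 \<Longrightarrow> psi x = 0 \<Longrightarrow> x = - b"
    using negative_zero by blast
  have "bessel_I_deriv_zero \<nu> = sqrt b"
    unfolding bessel_I_deriv_zero_def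
  proof (rule the_equality)
    show "0 < sqrt b \<and> deriv (bessel_I \<nu>) (sqrt b) = 0"
      using b by (simp add: deriv_bessel_I_zero_iff)
    fix x assume "0 < x \<and> deriv (bessel_I \<nu>) x = 0"
    then have "0 < x" "- x\<^sup>2 = - b" using b(3)[of "- x\<^sup>2"] by (auto simp: deriv_bessel_I_zero_iff)
    then show "x = sqrt b" using real_sqrt_unique[of x b] by simp
  qed
  then show "0 < bessel_I_deriv_zero \<nu>" "psi (- (bessel_I_deriv_zero \<nu>)\<^sup>2) = 0"
    using b by simp_all
qed

end

section \<open>The sum over the zeros of the derivative\<close>

theorem mainTheorem9:
  fixes \<nu> :: real and n :: nat
  assumes "-1 < \<nu>" and "\<nu> < 0" and "n \<ge> 1"
  shows "(\<lambda>k. (bessel_J_deriv_zero \<nu> (Suc k))\<^sup>2 /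
              (((bessel_J_deriv_zero \<nu> (Suc k))\<^sup>2 - \<nu>\<^sup>2) *
               ((bessel_J_zero \<nu> n)\<^sup>2 - (bessel_J_deriv_zero \<nu> (Suc k))\<^sup>2)\<^sup>2))
         sums
         (1 / (4 * (bessel_J_zero \<nu> n)\<^sup>2) -
          (bessel_I_deriv_zero \<nu>)\<^sup>2 /
            (((bessel_I_deriv_zero \<nu>)\<^sup>2 + \<nu>\<^sup>2) *
             ((bessel_J_zero \<nu> n)\<^sup>2 + (bessel_I_deriv_zero \<nu>)\<^sup>2)\<^sup>2))"
proof -
  interpret bessel_order \<nu> using assms by unfold_locales
  define jd where "jd = bessel_J_deriv_zero \<nu>"
  define b where "b = (bessel_I_deriv_zero \<nu>)\<^sup>2"
  define a where "a = (bessel_J_zero \<nu> n)\<^sup>2"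
  \<comment> \<open>All zeros of \<open>psi\<close> in ascending order: the negative one comes from \<open>I\<^sub>\<nu>'\<close>,
    and \<open>jd 0 = 0\<close> is not a zero, so index \<open>0\<close> is free for it.\<close>
  define e where "e k = (if k = 0 then - b else (jd k)\<^sup>2)" for k
  note J = pos_zero_Suc[OF finite_J_zeros J_zeros_unbounded, folded bessel_J_zero_def]
  note J' = pos_zero_Suc[OF finite_J_deriv_zeros J_deriv_zeros_unbounded,
      folded bessel_J_deriv_zero_def, folded jd_def]
  note enum = pos_zero_enumerates[OF finite_J_deriv_zeros J_deriv_zeros_unbounded,
      folded bessel_J_deriv_zero_def, folded jd_def]
  obtain m where m: "n = Suc m" using assms(3) by (cases n) auto
  have jn: "0 < bessel_J_zero \<nu> n" using J(1,2)[of m] by (simp add: m)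
  then have a: "0 < a" "phi a = 0"
    using J(3)[of m] bessel_J_zero_iff[OF jn] by (simp_all add: a_def m)
  have jd_pos: "0 < jd (Suc k)" for k using J'(1,2)[of k] by linarith
  have jd_zero: "psi ((jd (Suc k))\<^sup>2) = 0" for k
    using J'(3)[of k] deriv_bessel_J_zero_iff[OF jd_pos] by simp
  have b: "0 < b" "psi (- b) = 0" using I_deriv_zero by (simp_all add: b_def)
  have e_mono: "strict_mono e"
    unfolding strict_mono_Suc_iff
  proof
    fix k
    show "e k < e (Suc k)"
    proof (cases k)
      case 0
      have "0 < (jd (Suc 0))\<^sup>2" using jd_pos[of 0] by simp
      then have "- b < (jd (Suc 0))\<^sup>2" using b(1) by linarith
      then show ?thesis using 0 by (simp add: e_def)
    next
      case (Suc i)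
      then show ?thesis
        using J'(1,2)[of "Suc i"] by (simp add: e_def power_strict_mono)
    qed
  qed
  have e_lim: "filterlim e at_top sequentially"
  proof -
    have ev: "\<forall>\<^sub>F k in sequentially. (jd k)\<^sup>2 = e k"
      using eventually_gt_at_top[of "0::nat"] by eventually_elim (simp add: e_def)
    have "filterlim (\<lambda>k. (jd k)\<^sup>2) at_top sequentially"
      by (rule filterlim_pow_at_top[OF _ enum(3)]) simp
    then show ?thesis by (rule filterlim_cong[OF refl refl ev, THEN iffD1])
  qed
  have e_all: "x \<in> e ` {..<k}" if k: "0 < k" "\<bar>x\<bar> < e k" "psi x = 0" for k x
  proof (cases "x \<le> 0")
    case True
    obtain c :: real where c: "\<forall>x\<le>0. psi x = 0 \<longrightarrow> x = - c" using negative_zero by blast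
    have "x = - c" using c True k(3) by blast
    moreover have "- b = - c" using c[rule_format, of "- b"] b by linarith
    ultimately have "x = - b" by simp
    then have "x = e 0" by (simp add: e_def)
    then show ?thesis using k(1) by blast
  next
    case False
    then have "0 < sqrt x" "deriv (bessel_J \<nu>) (sqrt x) = 0"
      using k(3) by (simp_all add: deriv_bessel_J_zero_iff)
    then obtain i where i: "sqrt x = jd (Suc i)" using enum(2) by blast
    have "x = (sqrt x)\<^sup>2" using False by simp
    then have x: "x = e (Suc i)" by (simp add: i e_def)
    have "e (Suc i) < e k" using k(2) False by (simp flip: x)
    then have "Suc i < k" using strict_mono_less[OF e_mono] by blast
    then show ?thesis using x by blast
  qed
  have "(\<lambda>k. residue_weight (e k) / (a - e k)\<^sup>2) sums (1 / (2 * a))"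
  proof (rule mittag_leffler_derivative)
    show "inj e" using e_mono by (rule strict_mono_imp_inj_on)
    show "psi (e k) = 0" for k
      using b(2) jd_zero[of "k - 1"] by (cases k) (simp_all add: e_def)
    show "e 0 < 0" using b(1) by (simp add: e_def)
    show "0 < e k" if "0 < k" for k
      using that jd_pos[of "k - 1"] by (cases k) (simp_all add: e_def)
    show "x \<in> e ` {..<k}" if "0 < k" "\<bar>x\<bar> < e k" "psi x = 0" for k x
      using that by (rule e_all)
  qed (use e_lim a in simp_all)
  from sums_divide[OF this, of 2]
  have "(\<lambda>k. e k / ((e k - \<nu>\<^sup>2) * (a - e k)\<^sup>2)) sums (1 / (4 * a))"
    by (simp add: residue_weight_def)
  from sums_split_initial_segment[OF this, of 1]
  have "(\<lambda>k. (jd (Suc k))\<^sup>2 / (((jd (Suc k))\<^sup>2 - \<nu>\<^sup>2) * (a - (jd (Suc k))\<^sup>2)\<^sup>2)) sums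
        (1 / (4 * a) - (- b) / ((- b - \<nu>\<^sup>2) * (a - (- b))\<^sup>2))"
    by (simp add: e_def)
  also have "(- b) / ((- b - \<nu>\<^sup>2) * (a - (- b))\<^sup>2) = b / ((b + \<nu>\<^sup>2) * (a + b)\<^sup>2)"
  proof -
    have "(- b - \<nu>\<^sup>2) * (a - (- b))\<^sup>2 = - ((b + \<nu>\<^sup>2) * (a + b)\<^sup>2)" by (simp add: algebra_simps)
    then show ?thesis by (simp only: minus_divide_divide)
  qed
  finally show ?thesis by (simp add: jd_def a_def b_def)
qed

end
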